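(* For every integer $n\ge 2$, $$Kf(P_n)=5n\left(-\frac{\alpha_{3n-2}}{\alpha_{3n-1}}+\frac{\beta_{2n-1}}{\det(L_S)}\right)=5n\left(\frac{25n^2+30n-13}{60}+\frac{B_n}{(\sqrt2+\sqrt3)^{2n}+(\sqrt2-\sqrt3)^{2n}-2}\right)$$ and $$Kf(P'_n)=5n\left(-\frac{\alpha_{3n-2}}{\alpha_{3n-1}}+\frac{\beta'_{2n-1}}{\det(L'_S)}\right)=5n\left(\frac{25n^2+30n-13}{60}+\frac{B_n}{(\sqrt2+\sqrt3)^{2n}+(\sqrt2-\sqrt3)^{2n}+2}\right),$$ where $$B_n=\frac{7\sqrt6}{192}\left[(4-2\sqrt6)(5-2\sqrt6)^{n-1}-(4+2\sqrt6)(5+2\sqrt6)^{n-1}\right]+\frac{7\sqrt3}{48}\left[(4n-2\sqrt6\,n+1)(\sqrt3-\sqrt2)^{2n-1}+(4n+2\sqrt6\,n+1)(\sqrt3+\sqrt2)^{2n-1}\right].$$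
   Context: For $n\ge2$, the linear pentagonal cylinder graph $P_n$ is the simple graph on the $5n$ vertices $\tilde1,\dots,\tilde n$, $1,\dots,2n$, $1',\dots,(2n)'$ with edges: $\{i,i+1\}$ and $\{i',(i+1)'\}$ for $1\le i\le 2n-1$; $\{2n,1\}$ and $\{(2n)',1'\}$; $\{2k-1,(2k-1)'\}$ for $1\le k\le n$; $\{2k,\tilde k\}$ and $\{\tilde k,(2k)'\}$ for $1\le k\le n$. The pentagonal M\"obius chain graph $P'_n$ has the same vertices and edges except that $\{2n,1\}$ and $\{(2n)',1'\}$ are replaced by $\{2n,1'\}$ and $\{(2n)',1\}$. The Kirchhoff index of a connected graph $G$ is $Kf(G)=\sum_{i<j}r_{ij}$ (sum over unordered pairs of distinct vertices), where $r_{ij}$ is the effective resistance between vertices $i$ and $j$ when every edge is a unit resistor. Matrices: $L_A$ is the symmetric $3n\times3n$ matrix $\begin{bmatrix}2I_n & \sqrt2\,N\\ \sqrt2\,N^T & C\end{bmatrix}$, where $N$ is the $n\times 2n$ matrix with $N_{k,2k}=-1$ for $1\le k\le n$ and all other entries $0$, and $C$ is the symmetric $2n\times2n$ matrix with $C_{ii}=2$ for $i$ odd, $C_{ii}=3$ for $i$ even, $C_{i,i+1}=C_{i+1,i}=-1$ for $1\le i\le 2n-1$, $C_{1,2n}=C_{2n,1}=-1$, and all other entries $0$. $L_S$ (respectively $L'_S$) is the symmetric $2n\times 2n$ matrix with diagonal entries $4$ at odd positions and $3$ at even positions, entries $-1$ at positions $(i,i+1)$ and $(i+1,i)$ for $1\le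 i\le 2n-1$, entries $-1$ (respectively $+1$) at positions $(1,2n)$ and $(2n,1)$, and $0$ elsewhere. The numbers $\alpha_k$ are defined by $\det(xI_{3n}-L_A)=x^{3n}+\alpha_1x^{3n-1}+\cdots+\alpha_{3n-2}x^2+\alpha_{3n-1}x$ (the constant term is $0$). The numbers $\beta_{2n-1}$ and $\beta'_{2n-1}$ are the sums of all principal minors of order $2n-1$ of $L_S$ and $L'_S$ respectively (equivalently, minus the coefficient of $x$ in $\det(xI_{2n}-L_S)$, respectively $\det(xI_{2n}-L'_S)$). *)

theory Defs
  imports Complex_Main "Jordan_Normal_Form.Char_Poly" "Jordan_Normal_Form.DL_Submatrix"
begin

section \<open>Effective resistance and Kirchhoff index\<close>

text \<open>A simple graph is given by its vertex set \<open>V\<close> and its set \<open>E\<close> of two-element edges.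
  Every edge is a unit resistor, so by Ohm's law the current along an edge from \<open>w\<close> to \<open>z\<close> is
  \<open>\<phi> w - \<phi> z\<close>.  By Kirchhoff's current law, \<open>\<phi>\<close> is the potential of a unit current that enters
  at \<open>u\<close> and leaves at \<open>v\<close> iff the net current out of each vertex into the network is \<open>1\<close> at
  \<open>u\<close>, \<open>-1\<close> at \<open>v\<close> and \<open>0\<close> elsewhere.\<close>

definition unit_current_potential ::
    "'a set \<Rightarrow> 'a set set \<Rightarrow> 'a \<Rightarrow> 'a \<Rightarrow> ('a \<Rightarrow> real) \<Rightarrow> bool" where
  "unit_current_potential V E u v \<phi> \<longleftrightarrow>
     (\<forall>w\<in>V. (\<Sum>z | z \<in> V \<and> {w, z} \<in> E. \<phi> w - \<phi> z) =
              (if w = u then 1 else 0) - (if w = v then 1 else 0))"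

text \<open>In a finite connected graph such a potential exists and is unique on \<open>V\<close> up to an additive
  constant, so the description below denotes.\<close>

definition effective_resistance :: "'a set \<Rightarrow> 'a set set \<Rightarrow> 'a \<Rightarrow> 'a \<Rightarrow> real" where
  "effective_resistance V E u v =
     (THE r. \<exists>\<phi>. unit_current_potential V E u v \<phi> \<and> r = \<phi> u - \<phi> v)"

lemma effective_resistance_commute:
  "effective_resistance V E u v = effective_resistance V E v u"
proof -
  have flip: "unit_current_potential V E b a (\<lambda>x. - \<phi> x)"
    if "unit_current_potential V E a b \<phi>" for a b and \<phi> :: "'a \<Rightarrow> real"
    unfolding unit_current_potential_def
  proof
    fix w assume "w \<in> V"
    have "(\<Sum>z | z \<in> V \<and> {w, z} \<in> E. - \<phi> w - - \<phi> z) =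
          - (\<Sum>z | z \<in> V \<and> {w, z} \<in> E. \<phi> w - \<phi> z)"
      unfolding sum_negf [symmetric] by (rule sum.cong) auto
    then show "(\<Sum>z | z \<in> V \<and> {w, z} \<in> E. - \<phi> w - - \<phi> z) =
          (if w = b then 1 else 0) - (if w = a then 1 else 0)"
      using that \<open>w \<in> V\<close> unfolding unit_current_potential_def by simp
  qed
  have imp: "\<exists>\<phi>. unit_current_potential V E b a \<phi> \<and> r = \<phi> b - \<phi> a"
    if ex: "\<exists>\<phi>. unit_current_potential V E a b \<phi> \<and> r = \<phi> a - \<phi> b" for a b r
  proof -
    from ex obtain \<phi> where "unit_current_potential V E a b \<phi>" "r = \<phi> a - \<phi> b"
      by blast
    then show ?thesis
      by (intro exI [of _ "\<lambda>x. - \<phi> x"]) (simp add: flip)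
  qed
  have "(\<exists>\<phi>. unit_current_potential V E u v \<phi> \<and> r = \<phi> u - \<phi> v) \<longleftrightarrow>
        (\<exists>\<phi>. unit_current_potential V E v u \<phi> \<and> r = \<phi> v - \<phi> u)" for r
    using imp by blast
  then show ?thesis
    unfolding effective_resistance_def by presburger
qed

definition pair_resistance :: "'a set \<Rightarrow> 'a set set \<Rightarrow> 'a set \<Rightarrow> real" where
  "pair_resistance V E p = (THE r. \<exists>u v. p = {u, v} \<and> r = effective_resistance V E u v)"

lemma pair_resistance_insert:
  "pair_resistance V E {u, v} = effective_resistance V E u v"
  unfolding pair_resistance_def
proof (rule the_equality)
  show "\<exists>a b. {u, v} = {a, b} \<and> effective_resistance V E u v = effective_resistance V E a b"
    by blast
next
  fix r assume "\<exists>a b. {u, v} = {a, b} \<and> r = effective_resistance V E a b"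
  then show "r = effective_resistance V E u v"
    by (metis doubleton_eq_iff effective_resistance_commute)
qed

definition kirchhoff_index :: "'a set \<Rightarrow> 'a set set \<Rightarrow> real" where
  "kirchhoff_index V E = (\<Sum>p | p \<subseteq> V \<and> card p = 2. pair_resistance V E p)"


section \<open>Pentagonal cylinder and Moebius chain graphs\<close>

datatype vertex = Tilde nat | Unprimed nat | Primed nat

definition pent_vertices :: "nat \<Rightarrow> vertex set" where
  "pent_vertices n = Tilde ` {1..n} \<union> Unprimed ` {1..2*n} \<union> Primed ` {1..2*n}"

definition pent_chain_edges :: "nat \<Rightarrow> vertex set set" where
  "pent_chain_edges n =
     {{Unprimed i, Unprimed (i + 1)} | i. 1 \<le> i \<and> i \<le> 2*n - 1} \<union>
     {{Primed i, Primed (i + 1)} | i. 1 \<le> i \<and> i \<le> 2*n - 1} \<union>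
     {{Unprimed (2*k - 1), Primed (2*k - 1)} | k. 1 \<le> k \<and> k \<le> n} \<union>
     {{Unprimed (2*k), Tilde k} | k. 1 \<le> k \<and> k \<le> n} \<union>
     {{Tilde k, Primed (2*k)} | k. 1 \<le> k \<and> k \<le> n}"

definition cylinder_edges :: "nat \<Rightarrow> vertex set set" where
  "cylinder_edges n =
     pent_chain_edges n \<union> {{Unprimed (2*n), Unprimed 1}, {Primed (2*n), Primed 1}}"

definition moebius_edges :: "nat \<Rightarrow> vertex set set" where
  "moebius_edges n =
     pent_chain_edges n \<union> {{Unprimed (2*n), Primed 1}, {Primed (2*n), Unprimed 1}}"


section \<open>The matrices\<close>

text \<open>Matrix entries in the library are indexed from \<open>0\<close>; here they are given by a function of
  indices starting at \<open>1\<close>.\<close>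

definition mat_from_1 :: "nat \<Rightarrow> nat \<Rightarrow> (nat \<Rightarrow> nat \<Rightarrow> real) \<Rightarrow> real mat" where
  "mat_from_1 r c f = mat r c (\<lambda>(i, j). f (i + 1) (j + 1))"

text \<open>The common shape of the three \<open>2n \<times> 2n\<close> matrices: \<open>a\<close> and \<open>b\<close> are the diagonal
  entries at odd and even positions, \<open>c\<close> is the entry in the two off-diagonal corners.\<close>

definition periodic_mat :: "real \<Rightarrow> real \<Rightarrow> real \<Rightarrow> nat \<Rightarrow> real mat" where
  "periodic_mat a b c n = mat_from_1 (2*n) (2*n) (\<lambda>i j.
     if i = j then (if odd i then a else b)
     else if j = i + 1 \<or> i = j + 1 then -1
     else if (i = 1 \<and> j = 2*n) \<or> (i = 2*n \<and> j = 1) then c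
     else 0)"

definition N_mat :: "nat \<Rightarrow> real mat" where
  "N_mat n = mat_from_1 n (2*n) (\<lambda>k j. if j = 2*k then -1 else 0)"

definition C_mat :: "nat \<Rightarrow> real mat" where
  "C_mat n = periodic_mat 2 3 (-1) n"

definition L_A :: "nat \<Rightarrow> real mat" where
  "L_A n = four_block_mat
     (2 \<cdot>\<^sub>m 1\<^sub>m n) (sqrt 2 \<cdot>\<^sub>m N_mat n)
     (sqrt 2 \<cdot>\<^sub>m transpose_mat (N_mat n)) (C_mat n)"

definition L_S :: "nat \<Rightarrow> real mat" where
  "L_S n = periodic_mat 4 3 (-1) n"

definition L_S' :: "nat \<Rightarrow> real mat" where
  "L_S' n = periodic_mat 4 3 1 n"


section \<open>The coefficients\<close>

definition alpha :: "nat \<Rightarrow> nat \<Rightarrow> real" where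
  "alpha n k = coeff (char_poly (L_A n)) (3*n - k)"

definition principal_minor_sum :: "nat \<Rightarrow> real mat \<Rightarrow> real" where
  "principal_minor_sum k A =
     (\<Sum>I | I \<subseteq> {..<dim_row A} \<and> card I = k. det (submatrix A I I))"

definition beta :: "nat \<Rightarrow> real" where
  "beta n = principal_minor_sum (2*n - 1) (L_S n)"

definition beta' :: "nat \<Rightarrow> real" where
  "beta' n = principal_minor_sum (2*n - 1) (L_S' n)"

definition B_num :: "nat \<Rightarrow> real" where
  "B_num n =
     7 * sqrt 6 / 192 *
       ((4 - 2 * sqrt 6) * (5 - 2 * sqrt 6) ^ (n - 1)
        - (4 + 2 * sqrt 6) * (5 + 2 * sqrt 6) ^ (n - 1))
     + 7 * sqrt 3 / 48 *
       ((4 * real n - 2 * sqrt 6 * real n + 1) * (sqrt 3 - sqrt 2) ^ (2*n - 1)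
        + (4 * real n + 2 * sqrt 6 * real n + 1) * (sqrt 3 + sqrt 2) ^ (2*n - 1))"

end

theory Submission
  imports Defs
begin

text \<open>Both graphs have the reflection that exchanges \<open>Unprimed i\<close> with \<open>Primed i\<close> and fixes the vertices
  \<open>Tilde k\<close>.  On symmetric functions their Laplacian is \<open>L_A\<close>, the same for both graphs; on
  antisymmetric functions it is \<open>L_S\<close> for the cylinder and \<open>L_S'\<close> for the Moebius chain, where one
  turn exchanges the two strands and so changes the sign.  The Kirchhoff index is \<open>5n\<close> times the
  trace of the pseudoinverse of the Laplacian, hence \<open>5n\<close> times the sum of the trace of the
  pseudoinverse of \<open>L_A\<close> and that of the inverse of \<open>L_S\<close> or \<open>L_S'\<close>.  These traces are the quotients of coefficients and of
  minors in the theorem.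

  The proof uses no eigenvalues but explicit Green's functions.  If \<open>X\<close> is a matrix with
  \<open>L X = I - \<mu> 1\<^sup>T\<close> for some load vector \<open>\<mu>\<close>, then the Kirchhoff index is
  \<open>\<bar>V\<bar> \<sqdot> tr X - (\<Sum>w u. X w u)\<close> (\<open>kirchhoff_index_generalized_inverse\<close>).  The load is
  distributed evenly over the vertices \<open>Unprimed i\<close> and \<open>Primed i\<close>, with none on the vertices
  \<open>Tilde k\<close>.  Then the symmetric part of \<open>X\<close> reduces to the Green's function of the cycle of length
  \<open>2n\<close>, which is a quadratic polynomial in the distance (\<open>cycle_green\<close>).
  The antisymmetric part is a combination of powers of
  \<open>\<theta> = \<surd>3 + \<surd>2\<close> (\<open>screened_green\<close>): after a diagonal scaling, \<open>L_S\<close> is a multiple of the circulant matrix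
  with \<open>2 \<surd>3\<close> on the diagonal, and \<open>\<theta> + \<theta>\<^sup>-\<^sup>1 = 2 \<surd>3\<close>.  A sign \<open>s = \<plusminus> 1\<close>, the factor acquired on going
  once around, covers both graphs at once.

  On the side of the matrices, the inverse of \<open>L_S\<close> gives \<open>\<beta> / det L_S\<close> as its trace, since the
  adjugate is the determinant times the inverse (\<open>principal_minor_sum_quotient\<close>).  The quotient of the
  \<open>\<alpha>\<^sub>k\<close> is the trace of the pseudoinverse of \<open>L_A\<close>, computed from a nonsymmetric generalized
  inverse and the null vector (\<open>char_poly_coeff_quotient\<close>).  The correction that appears there and the
  sum over all entries of \<open>X\<close> are the same number \<open>sym_total n\<close>, so that the two sides agree.  The
  closed forms come from summing \<open>cycle_green\<close> over all pairs of positions, and from the value of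
  \<open>screened_green\<close> at distance \<open>0\<close>.\<close>

section \<open>The Kirchhoff index from a generalized inverse of the Laplacian\<close>

text \<open>Green's identity: the product terms \<open>f w * g w\<close> agree, and the mixed terms are exchanged by
  reversing the edges, as \<open>{w, z} = {z, w}\<close>.\<close>

lemma laplacian_symmetric:
  fixes f g :: "'a \<Rightarrow> real"
  assumes fin: "finite V"
  shows "(\<Sum>w\<in>V. f w * (\<Sum>z | z \<in> V \<and> {w, z} \<in> E. g w - g z)) =
         (\<Sum>w\<in>V. g w * (\<Sum>z | z \<in> V \<and> {w, z} \<in> E. f w - f z))"
proof -
  have restrict: "(\<Sum>w\<in>V. p w * (\<Sum>z | z \<in> V \<and> {w, z} \<in> E. q w - q z)) =
      (\<Sum>w\<in>V. \<Sum>z\<in>V. if {w, z} \<in> E then p w * (q w - q z) else 0)" for p q :: "'a \<Rightarrow> real"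
    by (intro sum.cong refl)
       (simp add: sum_distrib_left sum.inter_filter [OF fin, symmetric])
  have "(\<Sum>w\<in>V. \<Sum>z\<in>V. if {w, z} \<in> E then f z * g w else 0) =
        (\<Sum>w\<in>V. \<Sum>z\<in>V. if {w, z} \<in> E then f w * g z else 0)"
    by (subst sum.swap) (simp add: insert_commute)
  moreover have "(if {w, z} \<in> E then p w * (q w - q z) else 0) =
      (if {w, z} \<in> E then p w * q w else 0) - (if {w, z} \<in> E then p w * q z else 0)"
    for p q :: "'a \<Rightarrow> real" and w z
    by (simp add: algebra_simps)
  ultimately show ?thesis
    unfolding restrict by (simp add: sum_subtractf mult.commute cong: if_cong)
qed

lemma sum_over_unordered_pairs:
  fixes F :: "'a \<Rightarrow> 'a \<Rightarrow> real"
  assumes fin: "finite V"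
    and f: "\<And>u v. f {u, v} = F u v"
    and diag: "\<And>u. F u u = 0"
  shows "(\<Sum>p | p \<subseteq> V \<and> card p = 2. f p) = (\<Sum>u\<in>V. \<Sum>v\<in>V. F u v) / 2"
  using fin
proof (induction V rule: finite_induct)
  case empty
  have "{p :: 'a set. p \<subseteq> {} \<and> card p = 2} = {}"
    by auto
  then show ?case
    by (simp only: sum.empty div_0)
next
  case (insert x V)
  have sym: "F u v = F v u" for u v
    using f [of u v] f [of v u] by (simp add: insert_commute)
  have split: "{p. p \<subseteq> insert x V \<and> card p = 2} =
      {p. p \<subseteq> V \<and> card p = 2} \<union> (\<lambda>v. {x, v}) ` V"
  proof (intro equalityI subsetI)
    fix p assume "p \<in> {p. p \<subseteq> insert x V \<and> card p = 2}"
    then have p: "p \<subseteq> insert x V" "card p = 2"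
      by auto
    then obtain a b where ab: "p = {a, b}" "a \<noteq> b"
      by (auto simp: card_2_iff)
    show "p \<in> {p. p \<subseteq> V \<and> card p = 2} \<union> (\<lambda>v. {x, v}) ` V"
      using p ab by (cases "a = x"; cases "b = x") auto
  next
    fix p assume "p \<in> {p. p \<subseteq> V \<and> card p = 2} \<union> (\<lambda>v. {x, v}) ` V"
    then show "p \<in> {p. p \<subseteq> insert x V \<and> card p = 2}"
      using insert.hyps by (auto simp: card_2_iff)
  qed
  have disj: "{p. p \<subseteq> V \<and> card p = 2} \<inter> (\<lambda>v. {x, v}) ` V = {}"
    using insert.hyps by auto
  have inj: "inj_on (\<lambda>v. {x, v}) V"
    by (auto simp: inj_on_def doubleton_eq_iff)
  have "(\<Sum>p | p \<subseteq> insert x V \<and> card p = 2. f p) =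
        (\<Sum>u\<in>V. \<Sum>v\<in>V. F u v) / 2 + (\<Sum>v\<in>V. F x v)"
    unfolding split using insert.hyps
    by (subst sum.union_disjoint) (auto simp: disj insert.IH sum.reindex [OF inj] f)
  also have "\<dots> = (\<Sum>u\<in>insert x V. \<Sum>v\<in>insert x V. F u v) / 2"
    using insert.hyps sym [of _ x] by (simp add: sum.distrib diag)
  finally show ?case .
qed

text \<open>If \<open>X\<close> satisfies \<open>L X = I - \<mu> 1\<^sup>T\<close> for the Laplacian \<open>L\<close>, where \<open>\<mu>\<close> is any fixed load vector,
  then the column difference \<open>X(\<sqdot>,u) - X(\<sqdot>,v)\<close> is a potential of the unit current from \<open>u\<close> to \<open>v\<close>,
  because the loads cancel.  Transposing the equation also gives uniqueness: \<open>L \<psi> = 0\<close>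
  implies \<open>\<psi> = (\<Sum>w. \<mu> w * \<psi> w)\<close>, so \<open>\<psi>\<close> is constant.  Connectedness of the graph is therefore
  encoded in the existence of \<open>X\<close>.\<close>

lemma effective_resistance_eq:
  fixes X :: "'a \<Rightarrow> 'a \<Rightarrow> real"
  assumes fin: "finite V"
    and X: "\<And>w u. w \<in> V \<Longrightarrow> u \<in> V \<Longrightarrow>
      (\<Sum>z | z \<in> V \<and> {w, z} \<in> E. X w u - X z u) = (if w = u then 1 else 0) - \<mu> w"
    and u: "u \<in> V" and v: "v \<in> V"
  shows "effective_resistance V E u v = X u u - X u v - X v u + X v v"
proof -
  let ?L = "\<lambda>f w. \<Sum>z | z \<in> V \<and> {w, z} \<in> E. f w - f z :: real"
  have kernel: "\<psi> a = (\<Sum>w\<in>V. \<mu> w * \<psi> w)"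
    if "\<And>w. w \<in> V \<Longrightarrow> ?L \<psi> w = 0" and a: "a \<in> V" for \<psi> a
  proof -
    have "0 = (\<Sum>w\<in>V. X w a * ?L \<psi> w)"
      using that by simp
    also have "\<dots> = (\<Sum>w\<in>V. \<psi> w * ?L (\<lambda>w. X w a) w)"
      by (rule laplacian_symmetric [OF fin])
    also have "\<dots> = (\<Sum>w\<in>V. (if w = a then \<psi> w else 0) - \<mu> w * \<psi> w)"
      by (intro sum.cong refl) (simp add: X a algebra_simps)
    also have "\<dots> = \<psi> a - (\<Sum>w\<in>V. \<mu> w * \<psi> w)"
      using fin a by (simp add: sum_subtractf)
    finally show ?thesis
      by simp
  qed
  define \<phi>0 where "\<phi>0 = (\<lambda>w. X w u - X w v)"
  have diff: "?L (\<lambda>w. f w - g w) w = ?L f w - ?L g w" for f g w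
    by (subst sum_subtractf [symmetric]) (simp add: algebra_simps)
  have pot: "unit_current_potential V E u v \<phi>0"
    unfolding unit_current_potential_def
  proof
    fix w assume w: "w \<in> V"
    have "?L \<phi>0 w = ?L (\<lambda>w. X w u) w - ?L (\<lambda>w. X w v) w"
      unfolding \<phi>0_def by (rule diff)
    then show "?L \<phi>0 w = (if w = u then 1 else 0) - (if w = v then 1 else 0)"
      using w u v by (simp add: X)
  qed
  have uniq: "\<phi> u - \<phi> v = \<phi>0 u - \<phi>0 v" if "unit_current_potential V E u v \<phi>" for \<phi>
  proof -
    have "?L (\<lambda>w. \<phi> w - \<phi>0 w) w = 0" if "w \<in> V" for w
      unfolding diff
      using \<open>unit_current_potential V E u v \<phi>\<close> pot that
      unfolding unit_current_potential_def by simp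
    from kernel [OF this u] kernel [OF this v] show ?thesis
      by simp
  qed
  have "effective_resistance V E u v = \<phi>0 u - \<phi>0 v"
    unfolding effective_resistance_def
    by (rule the_equality) (use pot uniq in blast)+
  then show ?thesis
    by (simp add: \<phi>0_def)
qed

lemma kirchhoff_index_generalized_inverse:
  fixes X :: "'a \<Rightarrow> 'a \<Rightarrow> real"
  assumes fin: "finite V"
    and X: "\<And>w u. w \<in> V \<Longrightarrow> u \<in> V \<Longrightarrow>
      (\<Sum>z | z \<in> V \<and> {w, z} \<in> E. X w u - X z u) = (if w = u then 1 else 0) - \<mu> w"
  shows "kirchhoff_index V E =
      real (card V) * (\<Sum>u\<in>V. X u u) - (\<Sum>u\<in>V. \<Sum>v\<in>V. X u v)"
proof -
  define F where "F = (\<lambda>u v. if u \<in> V \<and> v \<in> V then X u u - X u v - X v u + X v v else 0)"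
  have F_sym: "F u v = F v u" for u v
    by (simp add: F_def)
  have "kirchhoff_index V E =
      (\<Sum>p | p \<subseteq> V \<and> card p = 2. THE r. \<exists>u v. p = {u, v} \<and> r = F u v)"
    unfolding kirchhoff_index_def
  proof (rule sum.cong [OF refl])
    fix p assume "p \<in> {p. p \<subseteq> V \<and> card p = 2}"
    then obtain a b where p: "p = {a, b}" "a \<in> V" "b \<in> V"
      by (auto simp: card_2_iff)
    have "(THE r. \<exists>u v. p = {u, v} \<and> r = F u v) = F a b"
      unfolding p by (rule the_equality) (use F_sym in \<open>auto simp: doubleton_eq_iff\<close>)
    then show "pair_resistance V E p = (THE r. \<exists>u v. p = {u, v} \<and> r = F u v)"
      using p effective_resistance_eq [OF fin X p(2,3)]
      by (simp add: pair_resistance_insert F_def)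
  qed
  also have "\<dots> = (\<Sum>u\<in>V. \<Sum>v\<in>V. F u v) / 2"
  proof (rule sum_over_unordered_pairs [OF fin])
    show "(THE r. \<exists>a b. {u, v} = {a, b} \<and> r = F a b) = F u v" for u v
      by (rule the_equality) (use F_sym in \<open>auto simp: doubleton_eq_iff\<close>)
  qed (simp add: F_def)
  also have "(\<Sum>u\<in>V. \<Sum>v\<in>V. F u v) = (\<Sum>u\<in>V. \<Sum>v\<in>V. X u u - X u v - X v u + X v v)"
    by (simp add: F_def)
  also have "\<dots> = 2 * (real (card V) * (\<Sum>u\<in>V. X u u) - (\<Sum>u\<in>V. \<Sum>v\<in>V. X u v))"
  proof -
    have "(\<Sum>u\<in>V. \<Sum>v\<in>V. X v u) = (\<Sum>u\<in>V. \<Sum>v\<in>V. X u v)"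
      by (rule sum.swap)
    then show ?thesis
      by (simp add: sum.distrib sum_subtractf sum_distrib_left algebra_simps)
  qed
  finally show ?thesis
    by simp
qed

section \<open>Traces of inverses and coefficients of characteristic polynomials\<close>

lemma submatrix_delete_index:
  assumes "A \<in> carrier_mat m m" and i: "i < m"
  shows "submatrix A ({..<m} - {i}) ({..<m} - {i}) = mat_delete A i i"
proof -
  let ?I = "{..<m} - {i}"
  have card: "card {a. a < m \<and> a \<in> ?I} = m - 1"
  proof -
    have "{a. a < m \<and> a \<in> ?I} = ?I"
      by auto
    then show ?thesis
      using i by simp
  qed
  have pick: "pick ?I k = insert_index i k" if "k < m - 1" for k
  proof -
    let ?a = "insert_index i k"
    have "?a \<in> ?I"
      using that i by (auto simp: insert_index_def)
    then have "?a = pick ?I (card {b \<in> ?I. b < ?a})"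
      using pick_card_in_set by metis
    moreover have "card {b \<in> ?I. b < ?a} = k"
    proof (cases "k < i")
      case True
      then have "{b \<in> ?I. b < ?a} = {..<k}"
        using that by auto
      then show ?thesis
        by simp
    next
      case False
      then have "{b \<in> ?I. b < ?a} = {..<Suc k} - {i}"
        using that by auto
      then show ?thesis
        using False by simp
    qed
    ultimately show ?thesis
      by simp
  qed
  have "submatrix A ?I ?I = mat (m - 1) (m - 1) (\<lambda>(k, l). A $$ (pick ?I k, pick ?I l))"
    using assms(1) card unfolding submatrix_def by (simp only: carrier_matD)
  then show ?thesis
    using assms by (intro eq_matI) (auto simp: pick mat_delete_def insert_index_def)
qed

lemma principal_minor_sum_corank_one:
  assumes A: "A \<in> carrier_mat m m" and m: "m > 0"
  shows "principal_minor_sum (m - 1) A = (\<Sum>i<m. det (mat_delete A i i))"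
proof -
  have sets: "{I. I \<subseteq> {..<m} \<and> card I = m - 1} = (\<lambda>i. {..<m} - {i}) ` {..<m}"
  proof (intro equalityI subsetI)
    fix I assume "I \<in> {I. I \<subseteq> {..<m} \<and> card I = m - 1}"
    then have I: "I \<subseteq> {..<m}" "card I = m - 1"
      by auto
    then have "card ({..<m} - I) = 1"
      using m by (subst card_Diff_subset) (auto intro: finite_subset)
    then obtain i where "{..<m} - I = {i}"
      by (auto simp: card_1_singleton_iff)
    then have "I = {..<m} - {i}" "i < m"
      using I by auto
    then show "I \<in> (\<lambda>i. {..<m} - {i}) ` {..<m}"
      by auto
  qed auto
  have inj: "inj_on (\<lambda>i. {..<m} - {i}) {..<m}"
    by (rule inj_onI) auto
  show ?thesis
    using A unfolding principal_minor_sum_def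
    by (simp add: sets sum.reindex [OF inj] submatrix_delete_index [OF A] del: One_nat_def)
qed

text \<open>Since \<open>adj A = det A \<sqdot> A\<^sup>-\<^sup>1\<close>, the sum of the principal minors of corank one is the trace of the
  inverse times the determinant.\<close>

lemma principal_cofactors_of_right_inverse:
  fixes A G :: "real mat"
  assumes A: "A \<in> carrier_mat m m" and G: "G \<in> carrier_mat m m" and inv: "A * G = 1\<^sub>m m"
  shows "det A \<noteq> 0"
    and "(\<Sum>i<m. det (mat_delete A i i)) = det A * (\<Sum>i<m. G $$ (i, i))"
proof -
  have "det A * det G = 1"
    using det_mult [OF A G] inv by simp
  then show "det A \<noteq> 0"
    by auto
  have "adj_mat A = adj_mat A * (A * G)"
    using adj_mat(1) [OF A] by (simp add: inv)
  also have "\<dots> = (adj_mat A * A) * G"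
    using adj_mat(1) [OF A] A G by (simp add: assoc_mult_mat [of _ m m _ m _ m])
  also have "\<dots> = det A \<cdot>\<^sub>m G"
    using G by (simp add: adj_mat(3) [OF A] mult_smult_assoc_mat [of _ m m])
  finally have adj: "adj_mat A = det A \<cdot>\<^sub>m G" .
  have "det (mat_delete A i i) = det A * G $$ (i, i)" if "i < m" for i
  proof -
    have "det (mat_delete A i i) = adj_mat A $$ (i, i)"
      using that A by (simp add: adj_mat_def cofactor_def)
    then show ?thesis
      using that G by (simp add: adj)
  qed
  then show "(\<Sum>i<m. det (mat_delete A i i)) = det A * (\<Sum>i<m. G $$ (i, i))"
    by (simp add: sum_distrib_left)
qed

lemma principal_minor_sum_quotient:
  fixes A G :: "real mat"
  assumes "A \<in> carrier_mat m m" "G \<in> carrier_mat m m" "A * G = 1\<^sub>m m" "m > 0"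
  shows "principal_minor_sum (m - 1) A / det A = (\<Sum>i<m. G $$ (i, i))"
  using principal_cofactors_of_right_inverse [OF assms(1-3)]
  by (simp add: principal_minor_sum_corank_one [OF assms(1,4)] del: One_nat_def)

lemma poly_char_poly:
  fixes A :: "'a :: comm_ring_1 mat"
  assumes A: "A \<in> carrier_mat m m"
  shows "poly (char_poly A) x = det (x \<cdot>\<^sub>m 1\<^sub>m m - A)"
  unfolding char_poly_def
  by (rule poly_det_cong [of _ m]) (use A in \<open>auto simp: char_poly_matrix_def\<close>)

text \<open>Compare the two triangular factorizations of the bordered matrix with blocks \<open>1\<close>, \<open>v\<^sup>T\<close>, \<open>u\<close>
  and the identity.\<close>

lemma det_one_minus_rank_one:
  fixes u v :: "real mat"
  assumes u: "u \<in> carrier_mat m 1" and v: "v \<in> carrier_mat 1 m"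
  shows "det (1\<^sub>m m - u * v) = det (1\<^sub>m 1 - v * u)"
proof -
  let ?B = "four_block_mat (1\<^sub>m 1) v u (1\<^sub>m m)"
  let ?C = "four_block_mat (1\<^sub>m 1) (0\<^sub>m 1 m) (- u) (1\<^sub>m m)"
  have B: "?B \<in> carrier_mat (1 + m) (1 + m)" and C: "?C \<in> carrier_mat (1 + m) (1 + m)"
    by auto
  have BC: "?B * ?C = four_block_mat (1\<^sub>m 1 - v * u) v (0\<^sub>m m 1) (1\<^sub>m m)"
    using u v
    by (subst mult_four_block_mat [of _ 1 1 _ m _ m _ _ 1 _ m])
       (auto intro!: cong_four_block_mat eq_matI simp: scalar_prod_def)
  have CB: "?C * ?B = four_block_mat (1\<^sub>m 1) v (0\<^sub>m m 1) (1\<^sub>m m - u * v)"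
    using u v
    by (subst mult_four_block_mat [of _ 1 1 _ m _ m _ _ 1 _ m])
       (auto intro!: cong_four_block_mat eq_matI simp: scalar_prod_def)
  have "det (?B * ?C) = det (?C * ?B)"
    by (simp only: det_mult [OF B C] det_mult [OF C B] mult.commute)
  moreover have "det (?B * ?C) = det (1\<^sub>m 1 - v * u)"
    unfolding BC using u v
    by (subst det_four_block_mat_lower_left_zero [of _ 1 _ m]) auto
  moreover have "det (?C * ?B) = det (1\<^sub>m m - u * v)"
    unfolding CB using u v
    by (subst det_four_block_mat_lower_left_zero [of _ 1 _ m]) auto
  ultimately show ?thesis
    by simp
qed

text \<open>The coefficients of degree \<open>0\<close> and \<open>1\<close> are, up to sign, the determinant and the sum of the
  principal cofactors, the latter because the derivative of a characteristic polynomial is the sum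
  of the characteristic polynomials of the principal submatrices of corank one.\<close>

lemma char_poly_low_coeffs:
  fixes A G :: "real mat"
  assumes A: "A \<in> carrier_mat m m" and G: "G \<in> carrier_mat m m" and inv: "A * G = 1\<^sub>m m"
    and m: "m > 0"
  shows "coeff (char_poly A) 0 \<noteq> 0"
    and "coeff (char_poly A) 1 = - (coeff (char_poly A) 0 * (\<Sum>i<m. G $$ (i, i)))"
proof -
  have const: "coeff (char_poly B) 0 = (-1) ^ k * det B" if "B \<in> carrier_mat k k"
    for B :: "real mat" and k
  proof -
    have "coeff (char_poly B) 0 = det (0 \<cdot>\<^sub>m 1\<^sub>m k - B)"
      using poly_char_poly [OF that, of 0] by (simp add: poly_0_coeff_0)
    also have "0 \<cdot>\<^sub>m 1\<^sub>m k - B = (-1) \<cdot>\<^sub>m B"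
      using that by (intro eq_matI) auto
    finally show ?thesis
      using that by (simp add: det_smult)
  qed
  note cof = principal_cofactors_of_right_inverse [OF A G inv]
  show "coeff (char_poly A) 0 \<noteq> 0"
    using cof(1) by (simp add: const [OF A])
  have del: "mat_delete A i i \<in> carrier_mat (m - 1) (m - 1)" for i
    by (rule mat_delete_carrier [OF A])
  have "coeff (char_poly A) 1 = coeff (pderiv (char_poly A)) 0"
    by (simp add: coeff_pderiv)
  also have "\<dots> = (-1) ^ (m - 1) * (\<Sum>i<m. det (mat_delete A i i))"
    by (simp add: pderiv_char_poly [OF A] coeff_sum const [OF del] sum_distrib_left del: One_nat_def)
  also have "(-1) ^ (m - 1) = - ((-1 :: real) ^ m)"
    using m by (cases m) auto
  finally show "coeff (char_poly A) 1 = - (coeff (char_poly A) 0 * (\<Sum>i<m. G $$ (i, i)))"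
    by (simp add: cof(2) const [OF A])
qed

text \<open>For a matrix \<open>L\<close> with null vector \<open>v\<close>, let \<open>P = v v\<^sup>T / (v\<^sup>T v)\<close> and \<open>M = L + P\<close>.
  As \<open>L P = 0\<close>, one has \<open>x I - M = (x I - L) (I - P / x)\<close>, and \<open>det (I - P / x) = 1 - 1 / x\<close>
  since \<open>P\<close> has rank one.  Hence \<open>x \<chi>\<^sub>M = (x - 1) \<chi>\<^sub>L\<close>:
  passing to \<open>M\<close> replaces one eigenvalue \<open>0\<close> by \<open>1\<close>.\<close>

lemma char_poly_shift_null_vector:
  fixes L :: "real mat" and v :: "nat \<Rightarrow> real" and s :: real
  assumes L: "L \<in> carrier_mat m m"
    and null: "\<And>i. i < m \<Longrightarrow> (\<Sum>k<m. L $$ (i, k) * v k) = 0"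
    and s: "s = (\<Sum>k<m. v k * v k)" "s \<noteq> 0"
  shows "[:0, 1:] * char_poly (L + mat m m (\<lambda>(i, j). v i * v j / s)) = [:-1, 1:] * char_poly L"
proof -
  let ?P = "mat m m (\<lambda>(i, j). v i * v j / s)"
  let ?u = "\<lambda>x. mat m 1 (\<lambda>(i, j). v i / (x * s))" and ?v = "mat 1 m (\<lambda>(i, j). v j)"
  have M: "L + ?P \<in> carrier_mat m m"
    using L by auto
  have at: "x * poly (char_poly (L + ?P)) x = (x - 1) * poly (char_poly L) x" if "x \<noteq> 0" for x
  proof -
    have Lu: "L * ?u x = 0\<^sub>m m 1"
    proof (rule eq_matI)
      fix i j assume "i < dim_row (0\<^sub>m m 1 :: real mat)" "j < dim_col (0\<^sub>m m 1 :: real mat)"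
      then have "(L * ?u x) $$ (i, j) = (\<Sum>k<m. L $$ (i, k) * v k) / (x * s)"
        using L by (simp add: scalar_prod_def lessThan_atLeast0 sum_divide_distrib)
      with \<open>i < _\<close> \<open>j < _\<close> show "(L * ?u x) $$ (i, j) = 0\<^sub>m m 1 $$ (i, j)"
        by (simp add: null)
    qed (use L in auto)
    have "(x \<cdot>\<^sub>m 1\<^sub>m m - L) * (1\<^sub>m m - ?u x * ?v) =
        (x \<cdot>\<^sub>m 1\<^sub>m m - L) - (x \<cdot>\<^sub>m 1\<^sub>m m - L) * (?u x * ?v)"
      using L by (subst mult_minus_distrib_mat [of _ m m _ m]) auto
    also have "(x \<cdot>\<^sub>m 1\<^sub>m m - L) * (?u x * ?v) = x \<cdot>\<^sub>m (?u x * ?v) - (L * ?u x) * ?v"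
    proof -
      have uv: "?u x * ?v \<in> carrier_mat m m"
        by (rule carrier_matI) auto
      have "(x \<cdot>\<^sub>m 1\<^sub>m m - L) * (?u x * ?v) = x \<cdot>\<^sub>m 1\<^sub>m m * (?u x * ?v) - L * (?u x * ?v)"
        by (rule minus_mult_distrib_mat [OF _ L uv]) auto
      also have "x \<cdot>\<^sub>m 1\<^sub>m m * (?u x * ?v) = x \<cdot>\<^sub>m (?u x * ?v)"
        using mult_smult_assoc_mat [OF one_carrier_mat uv, of x] left_mult_one_mat [OF uv] by simp
      also have "L * (?u x * ?v) = (L * ?u x) * ?v"
        by (rule assoc_mult_mat [OF L, symmetric]) auto
      finally show ?thesis .
    qed
    also have "(L * ?u x) * ?v = 0\<^sub>m m m"
      unfolding Lu by (rule left_mult_zero_mat) auto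
    also have "x \<cdot>\<^sub>m (?u x * ?v) - 0\<^sub>m m m = ?P"
      using that s(2) by (intro eq_matI) (auto simp: scalar_prod_def)
    also have "x \<cdot>\<^sub>m 1\<^sub>m m - L - ?P = x \<cdot>\<^sub>m 1\<^sub>m m - (L + ?P)"
      using L by (intro eq_matI) auto
    finally have "det (x \<cdot>\<^sub>m 1\<^sub>m m - (L + ?P)) = det (x \<cdot>\<^sub>m 1\<^sub>m m - L) * det (1\<^sub>m m - ?u x * ?v)"
      using L by (subst det_mult [symmetric, of _ m]) auto
    also have "det (1\<^sub>m m - ?u x * ?v) = det (1\<^sub>m 1 - ?v * ?u x)"
      by (rule det_one_minus_rank_one) auto
    also have "\<dots> = 1 - (?v * ?u x) $$ (0, 0)"
      by (subst det_single) auto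
    also have "(?v * ?u x) $$ (0, 0) = s / (x * s)"
      by (simp add: scalar_prod_def lessThan_atLeast0 s(1) sum_divide_distrib)
    finally show ?thesis
      using that s(2) by (simp add: poly_char_poly [OF L] poly_char_poly [OF M] field_simps)
  qed
  have "[:0, 1:] * ([:0, 1:] * char_poly (L + ?P)) = [:0, 1:] * ([:-1, 1:] * char_poly L)"
  proof (rule poly_ext)
    fix x
    show "poly ([:0, 1:] * ([:0, 1:] * char_poly (L + ?P))) x =
          poly ([:0, 1:] * ([:-1, 1:] * char_poly L)) x"
      using at [of x] by (cases "x = 0") (simp_all add: left_diff_distrib)
  qed
  then show ?thesis
    by (subst (asm) mult_left_cancel) auto
qed

text \<open>For a symmetric \<open>L\<close> with one-dimensional kernel, the left-hand side is the sum of the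
  reciprocals of the nonzero eigenvalues, that is, the trace of the pseudoinverse.  The
  pseudoinverse is \<open>Y = (I - P) z (I - P)\<close> for any \<open>z\<close> with \<open>L z = I - w v\<^sup>T\<close>, and \<open>Y + P\<close>
  inverts \<open>L + P\<close>.\<close>

lemma char_poly_coeff_quotient:
  fixes L :: "real mat" and z :: "nat \<Rightarrow> nat \<Rightarrow> real" and v w :: "nat \<Rightarrow> real" and s :: real
  assumes L: "L \<in> carrier_mat m m" and m: "m > 0"
    and null: "\<And>i. i < m \<Longrightarrow> (\<Sum>k<m. L $$ (i, k) * v k) = 0"
    and ginv: "\<And>i j. i < m \<Longrightarrow> j < m \<Longrightarrow>
      (\<Sum>k<m. L $$ (i, k) * z k j) = (if i = j then 1 else 0) - w i * v j"
    and s: "s = (\<Sum>k<m. v k * v k)" "s \<noteq> 0"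
  shows "- (coeff (char_poly L) 2 / coeff (char_poly L) 1) =
    (\<Sum>i<m. z i i) - (\<Sum>i<m. \<Sum>j<m. v i * v j * z i j) / s"
proof -
  let ?P = "mat m m (\<lambda>(i, j). v i * v j / s)"
  define M where "M = L + ?P"
  have M: "M \<in> carrier_mat m m"
    using L by (auto simp: M_def)
  define row where "row j = (\<Sum>k<m. v k * z k j)" for j
  define col where "col i = (\<Sum>k<m. z i k * v k)" for i
  define q where "q = (\<Sum>k<m. v k * col k)"
  have q_row: "q = (\<Sum>k<m. row k * v k)"
  proof -
    have "q = (\<Sum>k<m. \<Sum>l<m. v k * z k l * v l)"
      by (simp add: q_def col_def sum_distrib_left mult.assoc)
    also have "\<dots> = (\<Sum>k<m. row k * v k)"
      by (subst sum.swap) (simp add: row_def sum_distrib_right)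
    finally show ?thesis .
  qed
  \<comment> \<open>\<open>R\<close> is \<open>(I - P) z (I - P) + P\<close> multiplied out.\<close>
  define R where "R = mat m m (\<lambda>(i, j).
     z i j - v i * row j / s - col i * v j / s + v i * v j * q / s\<^sup>2 + v i * v j / s)"
  have R: "R \<in> carrier_mat m m"
    by (simp add: R_def)
  have Lcol: "(\<Sum>k<m. L $$ (i, k) * col k) = v i - w i * s" if "i < m" for i
  proof -
    have "(\<Sum>k<m. L $$ (i, k) * col k) = (\<Sum>k<m. \<Sum>l<m. L $$ (i, k) * z k l * v l)"
      by (simp add: col_def sum_distrib_left mult.assoc)
    also have "\<dots> = (\<Sum>l<m. (\<Sum>k<m. L $$ (i, k) * z k l) * v l)"
      by (subst sum.swap) (simp add: sum_distrib_right)
    also have "\<dots> = (\<Sum>l<m. (if i = l then v l else 0) - w i * (v l * v l))"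
      by (intro sum.cong refl) (simp add: ginv that left_diff_distrib mult.assoc)
    also have "\<dots> = v i - w i * s"
      using that by (simp add: sum_subtractf s(1) sum_distrib_left)
    finally show ?thesis .
  qed
  have inv: "M * R = 1\<^sub>m m"
  proof (rule eq_matI)
    fix i j assume "i < dim_row (1\<^sub>m m :: real mat)" "j < dim_col (1\<^sub>m m :: real mat)"
    then have i: "i < m" and j: "j < m"
      by auto
    have "(M * R) $$ (i, j) = (\<Sum>k<m. (L $$ (i, k) + v i * v k / s) *
        (z k j - v k * row j / s - col k * v j / s + v k * v j * q / s\<^sup>2 + v k * v j / s))"
      using i j L by (simp add: M_def R_def scalar_prod_def lessThan_atLeast0)
    also have "\<dots> = (\<Sum>k<m. L $$ (i, k) * z k j - L $$ (i, k) * v k * (row j / s)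
          - L $$ (i, k) * col k * (v j / s) + L $$ (i, k) * v k * (v j * q / s\<^sup>2)
          + L $$ (i, k) * v k * (v j / s)
          + (v k * z k j * (v i / s) - v k * v k * (v i * row j / s\<^sup>2)
          - v k * col k * (v i * v j / s\<^sup>2) + v k * v k * (v i * v j * q / s ^ 3)
          + v k * v k * (v i * v j / s\<^sup>2)))"
      by (intro sum.cong refl) (simp add: algebra_simps power2_eq_square power3_eq_cube)
    also have "\<dots> = (if i = j then 1 else 0) - w i * v j - (v i - w i * s) * (v j / s)
          + (row j * (v i / s) - s * (v i * row j / s\<^sup>2)
          - q * (v i * v j / s\<^sup>2) + s * (v i * v j * q / s ^ 3)
          + s * (v i * v j / s\<^sup>2))"
      by (simp only: sum.distrib sum_subtractf sum_distrib_right [symmetric] null [OF i]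
          ginv [OF i j] Lcol [OF i] row_def [symmetric] q_def [symmetric] s(1) [symmetric] mult_zero_left diff_zero add_0_right)
    also have "\<dots> = (if i = j then 1 else 0)"
      using s(2) by (simp add: field_simps power2_eq_square power3_eq_cube)
    finally show "(M * R) $$ (i, j) = 1\<^sub>m m $$ (i, j)"
      using i j by simp
  qed (use M R in auto)
  have "(\<Sum>i<m. R $$ (i, i)) = (\<Sum>i<m. z i i - v i * row i / s - col i * v i / s
      + v i * v i * q / s\<^sup>2 + v i * v i / s)"
    by (simp add: R_def)
  also have "\<dots> = (\<Sum>i<m. z i i) - q / s - q / s + s * q / s\<^sup>2 + s / s"
  proof -
    have "(\<Sum>i<m. v i * row i) = q" "(\<Sum>i<m. col i * v i) = q"
      by (simp_all only: q_row q_def [unfolded q_row] mult.commute)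
    then show ?thesis
      by (simp only: sum.distrib sum_subtractf sum_divide_distrib [symmetric]
          sum_distrib_right [symmetric] s(1) [symmetric])
  qed
  also have "\<dots> = (\<Sum>i<m. z i i) - q / s + 1"
    using s(2) by (simp add: field_simps power2_eq_square)
  finally have trace: "(\<Sum>i<m. R $$ (i, i)) = (\<Sum>i<m. z i i) - q / s + 1" .
  have q: "q = (\<Sum>i<m. \<Sum>j<m. v i * v j * z i j)"
    by (simp add: q_def col_def sum_distrib_left mult_ac)
  note low = char_poly_low_coeffs [OF M R inv m]
  have shift: "[:0, 1:] * char_poly M = [:-1, 1:] * char_poly L"
    unfolding M_def by (rule char_poly_shift_null_vector [OF L null s])
  have c0: "coeff (char_poly L) 0 = 0"
    using arg_cong [OF shift, of "\<lambda>p. coeff p 0"] by simp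
  have c1: "coeff (char_poly M) 0 = - coeff (char_poly L) 1"
    using arg_cong [OF shift, of "\<lambda>p. coeff p 1"] c0 by simp
  have c2: "coeff (char_poly M) 1 = coeff (char_poly L) 1 - coeff (char_poly L) 2"
    using arg_cong [OF shift, of "\<lambda>p. coeff p 2"]
    by (simp add: numeral_2_eq_2)
  have "coeff (char_poly L) 1 \<noteq> 0"
    using low(1) c1 by simp
  moreover have "coeff (char_poly L) 2 = coeff (char_poly L) 1 * (1 - (\<Sum>i<m. R $$ (i, i)))"
    using low(2) c1 c2 by (simp add: algebra_simps)
  ultimately show ?thesis
    by (simp add: trace q)
qed

section \<open>Green's functions on the cycle\<close>

definition gap :: "nat \<Rightarrow> nat \<Rightarrow> nat" where
  "gap i j = (i - j) + (j - i)"

lemma gap_self [simp]: "gap i i = 0"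
  by (simp add: gap_def)

text \<open>Positions run through \<open>1..m\<close>, but a function of the gap makes sense at \<open>0\<close> and \<open>m + 1\<close> too.
  With \<open>s = 1\<close> the next lemma says that these two values continue it around the cycle; with
  \<open>s = -1\<close> they do so with a change of sign, as one turn of a Moebius band does to an
  antisymmetric function.\<close>

lemma gap_function_wrap:
  fixes h :: "nat \<Rightarrow> real"
  assumes refl: "\<And>d. d \<le> m \<Longrightarrow> h (m - d) = s * h d" and j: "1 \<le> j" "j \<le> m"
  shows "h (gap 0 j) = s * h (gap m j)" and "h (gap (m + 1) j) = s * h (gap 1 j)"
proof -
  show "h (gap 0 j) = s * h (gap m j)"
    using refl [of "m - j"] j by (simp add: gap_def)
  show "h (gap (m + 1) j) = s * h (gap 1 j)"
    using refl [of "j - 1"] j by (simp add: gap_def Suc_diff_le)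
qed

lemma gap_function_second_difference:
  fixes h :: "nat \<Rightarrow> real"
  assumes rec: "\<And>d. 1 \<le> d \<Longrightarrow> d < m \<Longrightarrow> a * h d - h (d - 1) - h (d + 1) = r"
    and origin: "a * h 0 - 2 * h 1 = r + 1"
    and i: "1 \<le> i" "i \<le> m" and j: "1 \<le> j" "j \<le> m"
  shows "a * h (gap i j) - h (gap (i - 1) j) - h (gap (i + 1) j) = r + (if i = j then 1 else 0)"
proof (cases i j rule: linorder_cases)
  case less
  then have "gap i j = j - i" "gap (i - 1) j = (j - i) + 1" "gap (i + 1) j = (j - i) - 1"
    using i by (auto simp: gap_def)
  then show ?thesis
    using rec [of "j - i"] less i j by (simp add: algebra_simps)
next
  case equal
  then have "gap i j = 0" "gap (i - 1) j = 1" "gap (i + 1) j = 1"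
    using i by (auto simp: gap_def)
  then show ?thesis
    using origin equal by simp
next
  case greater
  then have "gap i j = i - j" "gap (i - 1) j = (i - j) - 1" "gap (i + 1) j = (i - j) + 1"
    by (auto simp: gap_def)
  then show ?thesis
    using rec [of "i - j"] greater i j by simp
qed

text \<open>The Green's function of the Laplacian of the cycle of length \<open>2n\<close>, relative to the uniform
  load.\<close>

definition cycle_green :: "nat \<Rightarrow> nat \<Rightarrow> real" where
  "cycle_green n d = - (real d * (2 * real n - real d)) / (4 * real n)"

lemma cycle_green_0 [simp]: "cycle_green n 0 = 0"
  by (simp add: cycle_green_def)

lemma cycle_green_reflect:
  assumes "d \<le> 2 * n"
  shows "cycle_green n (2 * n - d) = cycle_green n d"
  using assms by (simp add: cycle_green_def of_nat_diff algebra_simps)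

lemma cycle_green_equation:
  assumes "1 \<le> i" "i \<le> 2 * n" "1 \<le> j" "j \<le> 2 * n"
  shows "2 * cycle_green n (gap i j) - cycle_green n (gap (i - 1) j) - cycle_green n (gap (i + 1) j)
    = (if i = j then 1 else 0) - 1 / (2 * real n)"
proof -
  have n: "n > 0"
    using assms by simp
  have "2 * cycle_green n d - cycle_green n (d - 1) - cycle_green n (d + 1) = - 1 / (2 * real n)"
    if "1 \<le> d" for d
    using that n by (simp add: cycle_green_def of_nat_diff field_simps)
  moreover have "2 * cycle_green n 0 - 2 * cycle_green n 1 = - 1 / (2 * real n) + 1"
    using n by (simp add: cycle_green_def field_simps)
  ultimately show ?thesis
    using gap_function_second_difference
      [where h = "cycle_green n" and a = 2 and r = "- 1 / (2 * real n)" and m = "2 * n"] assms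
    by simp
qed

definition theta :: real where
  "theta = sqrt 3 + sqrt 2"

lemma theta_inverse: "theta * (sqrt 3 - sqrt 2) = 1"
  by (simp add: theta_def algebra_simps)

lemma theta_square: "theta * theta = 2 * sqrt 3 * theta - 1"
  by (simp add: theta_def algebra_simps)

lemma theta_gt_1: "theta > 1"
proof -
  have "sqrt 3 > 1" "sqrt 2 > 0"
    by simp_all
  then show ?thesis
    unfolding theta_def by linarith
qed

text \<open>The numbers \<open>\<theta>\<close> and \<open>\<theta>\<^sup>-\<^sup>1\<close> are the roots of \<open>x\<^sup>2 - 2 \<surd>3 x + 1\<close>.  Hence this combination of
  \<open>\<theta>\<^sup>d\<close> and \<open>\<theta>\<^sup>-\<^sup>d\<close> inverts the operator with \<open>2 \<surd>3\<close> on the diagonal and \<open>-1\<close> next to it, on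
  functions on \<open>2n\<close> points which are multiplied by \<open>s\<close> on going once around.\<close>

definition screened_green :: "nat \<Rightarrow> real \<Rightarrow> nat \<Rightarrow> real" where
  "screened_green n s d =
     (theta ^ (2 * n - d) + s * theta ^ d) / (2 * sqrt 2 * (theta ^ (2 * n) - s))"

lemma screened_green_reflect:
  assumes "d \<le> 2 * n" and s: "s * s = 1"
  shows "screened_green n s (2 * n - d) = s * screened_green n s d"
  using assms by (simp add: screened_green_def distrib_left add.commute)

lemma screened_green_recurrence:
  assumes "1 \<le> d" "d < 2 * n"
  shows "2 * sqrt 3 * screened_green n s d - screened_green n s (d - 1)
         - screened_green n s (d + 1) = 0"
proof -
  have root: "2 * sqrt 3 * theta ^ Suc k - theta ^ k - theta ^ Suc (Suc k) = 0" for k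
  proof -
    have "2 * sqrt 3 * theta ^ Suc k - theta ^ k - theta ^ Suc (Suc k) =
        theta ^ k * (2 * sqrt 3 * theta - 1 - theta * theta)"
      by (simp add: algebra_simps)
    then show ?thesis
      by (simp only: theta_square) simp
  qed
  obtain e where e: "d = Suc e"
    using assms by (cases d) auto
  obtain k where k: "2 * n = Suc d + k"
    using assms less_iff_Suc_add by auto
  have sub: "2 * n - Suc e = Suc k" "2 * n - e = Suc (Suc k)" "2 * n - Suc (Suc e) = k"
    using k e by auto
  define D where "D = 2 * sqrt 2 * (theta ^ (2 * n) - s)"
  have vals: "screened_green n s (Suc e) = (theta ^ Suc k + s * theta ^ Suc e) / D"
    "screened_green n s e = (theta ^ Suc (Suc k) + s * theta ^ e) / D"
    "screened_green n s (Suc (Suc e)) = (theta ^ k + s * theta ^ Suc (Suc e)) / D"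
    unfolding screened_green_def sub D_def by (rule refl)+
  have "2 * sqrt 3 * screened_green n s (Suc e) - screened_green n s e
      - screened_green n s (Suc (Suc e)) =
      ((2 * sqrt 3 * theta ^ Suc k - theta ^ k - theta ^ Suc (Suc k)) +
      s * (2 * sqrt 3 * theta ^ Suc e - theta ^ e - theta ^ Suc (Suc e))) / D"
  proof -
    have "b * ((x1 + s * y1) / D) - (x2 + s * y0) / D - (x0 + s * y2) / D =
        ((b * x1 - x0 - x2) + s * (b * y1 - y0 - y2)) / D" for b x0 x1 x2 y0 y1 y2
      by (simp add: algebra_simps add_divide_distrib diff_divide_distrib)
    then show ?thesis
      unfolding vals .
  qed
  also have "\<dots> = 0"
    by (simp only: root) simp
  finally show ?thesis
    by (simp add: e)
qed

lemma screened_green_origin: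
  assumes n: "n > 0" and s: "s \<le> 1"
  shows "2 * sqrt 3 * screened_green n s 0 - 2 * screened_green n s 1 = 1"
proof -
  have pos: "theta ^ (2 * n) - s > 0"
    using one_less_power [OF theta_gt_1, of "2 * n"] n s by linarith
  have "theta ^ (2 * n - 1) = theta ^ (2 * n) * (sqrt 3 - sqrt 2)"
  proof -
    have "2 * n = Suc (2 * n - 1)"
      using n by simp
    then have "theta ^ (2 * n) = theta * theta ^ (2 * n - 1)"
      by (metis power_Suc)
    then show ?thesis
      using theta_inverse by (simp add: mult_ac)
  qed
  then have "2 * sqrt 3 * (theta ^ (2 * n) + s) - 2 * (theta ^ (2 * n - 1) + s * theta) =
      2 * sqrt 2 * (theta ^ (2 * n) - s)"
    by (simp add: theta_def algebra_simps)
  moreover have "2 * sqrt 3 * screened_green n s 0 - 2 * screened_green n s 1 =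
      (2 * sqrt 3 * (theta ^ (2 * n) + s) - 2 * (theta ^ (2 * n - 1) + s * theta)) /
      (2 * sqrt 2 * (theta ^ (2 * n) - s))"
    by (simp add: screened_green_def diff_divide_distrib)
  ultimately show ?thesis
    using pos by simp
qed

text \<open>Multiplying the block with diagonal entries \<open>4\<close>, \<open>3\<close> by \<open>diag \<kappa>\<close> on both sides gives \<open>2 \<surd>3\<close> times
  the matrix with \<open>2 \<surd>3\<close> on the diagonal and \<open>-1\<close> next to it, because
  \<open>4 \<kappa>\<^sub>o\<^sub>d\<^sub>d\<^sup>2 = 3 \<kappa>\<^sub>e\<^sub>v\<^sub>e\<^sub>n\<^sup>2 = 12\<close> and \<open>\<kappa>\<^sub>o\<^sub>d\<^sub>d \<kappa>\<^sub>e\<^sub>v\<^sub>e\<^sub>n = 2 \<surd>3\<close>.\<close>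

definition kappa :: "nat \<Rightarrow> real" where
  "kappa i = (if odd i then sqrt 3 else 2)"

definition antisym_green :: "nat \<Rightarrow> real \<Rightarrow> nat \<Rightarrow> nat \<Rightarrow> real" where
  "antisym_green n s i j = kappa i * kappa j * screened_green n s (gap i j) / (2 * sqrt 3)"

lemma antisym_green_wrap:
  assumes "1 \<le> j" "j \<le> 2 * n" and s: "s * s = 1"
  shows "antisym_green n s 0 j = s * antisym_green n s (2 * n) j"
    and "antisym_green n s (2 * n + 1) j = s * antisym_green n s 1 j"
proof -
  have refl: "screened_green n s (2 * n - d) = s * screened_green n s d" if "d \<le> 2 * n" for d
    using that s by (rule screened_green_reflect)
  have wrap: "screened_green n s (gap 0 j) = s * screened_green n s (gap (2 * n) j)"
    "screened_green n s (gap (2 * n + 1) j) = s * screened_green n s (gap 1 j)"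
    by (rule gap_function_wrap [where h = "screened_green n s" and s = s, OF refl assms(1,2)],
        assumption)+
  have parity: "kappa 0 = kappa (2 * n)" "kappa (2 * n + 1) = kappa 1"
    by (simp_all add: kappa_def)
  show "antisym_green n s 0 j = s * antisym_green n s (2 * n) j"
    by (simp only: antisym_green_def wrap(1) parity(1)) simp
  show "antisym_green n s (2 * n + 1) j = s * antisym_green n s 1 j"
    by (simp only: antisym_green_def wrap(2) parity(2)) simp
qed

lemma antisym_green_equation:
  assumes i: "1 \<le> i" "i \<le> 2 * n" and j: "1 \<le> j" "j \<le> 2 * n" and s: "s \<le> 1"
  shows "(if odd i then 4 else 3) * antisym_green n s i j
      - antisym_green n s (i - 1) j - antisym_green n s (i + 1) j = (if i = j then 1 else 0)"
proof -
  let ?h = "\<lambda>i. screened_green n s (gap i j)"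
  have n: "n > 0"
    using i by simp
  have eq: "2 * sqrt 3 * ?h i - ?h (i - 1) - ?h (i + 1) = 0 + (if i = j then 1 else 0)"
    by (rule gap_function_second_difference [OF screened_green_recurrence _ i j])
       (simp_all add: screened_green_origin [OF n s] del: One_nat_def)
  have parity: "kappa (i - 1) = kappa (i + 1)"
    using i by (auto simp: kappa_def)
  define a :: real where "a = (if odd i then 4 else 3)"
  have diag: "a * kappa i = 2 * sqrt 3 * kappa (i + 1)"
    by (simp add: kappa_def a_def)
  have "a * antisym_green n s i j - antisym_green n s (i - 1) j - antisym_green n s (i + 1) j =
      (a * kappa i * ?h i - kappa (i - 1) * ?h (i - 1) - kappa (i + 1) * ?h (i + 1)) *
      (kappa j / (2 * sqrt 3))"
  proof -
    have "a * (k * l * x / c) - k' * l * y / c - k'' * l * z / c =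
        (a * k * x - k' * y - k'' * z) * (l / c)" for k k' k'' l x y z c :: real
      by (simp add: algebra_simps diff_divide_distrib)
    then show ?thesis
      unfolding antisym_green_def .
  qed
  also have "\<dots> = (2 * sqrt 3 * ?h i - ?h (i - 1) - ?h (i + 1)) *
      (kappa (i + 1) * kappa j / (2 * sqrt 3))"
  proof -
    have "(b * k * x - k * y - k * z) * (l / c) = (b * x - y - z) * (k * l / c)"
      for b k l x y z c :: real
      by (simp add: algebra_simps diff_divide_distrib add_divide_distrib)
    then show ?thesis
      unfolding parity diag .
  qed
  also have "\<dots> = (if i = j then 1 else 0)"
    unfolding eq by (cases "i = j") (simp_all add: kappa_def)
  finally show ?thesis
    unfolding a_def .
qed

section \<open>Sums over the cycle\<close>

lemma sum_gap_function:
  fixes h :: "nat \<Rightarrow> real"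
  assumes refl: "\<And>d. d \<le> m \<Longrightarrow> h (m - d) = h d" and i: "1 \<le> i" "i \<le> m"
  shows "(\<Sum>j = 1..m. h (gap i j)) = (\<Sum>d<m. h d)"
proof -
  have "{1..m} = {1..i} \<union> {i+1..m}"
    using i by auto
  then have "(\<Sum>j = 1..m. h (gap i j)) = (\<Sum>j = 1..i. h (gap i j)) + (\<Sum>j = i+1..m. h (gap i j))"
    by (simp add: sum.union_disjoint)
  also have "(\<Sum>j = 1..i. h (gap i j)) = (\<Sum>d<i. h d)"
    by (rule sum.reindex_bij_witness [of _ "\<lambda>d. i - d" "\<lambda>j. i - j"]) (auto simp: gap_def)
  also have "(\<Sum>j = i+1..m. h (gap i j)) = (\<Sum>d = i..<m. h d)"
  proof (rule sum.reindex_bij_witness [of _ "\<lambda>d. i + m - d" "\<lambda>j. i + m - j"])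
    fix j assume j: "j \<in> {i+1..m}"
    then have "m - (j - i) = i + m - j" "j - i \<le> m"
      by auto
    then show "h (i + m - j) = h (gap i j)"
      using refl [of "j - i"] j by (simp add: gap_def)
  qed auto
  also have "(\<Sum>d<i. h d) + (\<Sum>d = i..<m. h d) = (\<Sum>d<m. h d)"
    using i by (simp add: lessThan_atLeast0 sum.atLeastLessThan_concat)
  finally show ?thesis .
qed

lemma sum_cycle_green:
  assumes n: "n > 0"
  shows "(\<Sum>d<2 * n. cycle_green n d) = - (4 * real n ^ 2 - 1) / 12"
proof -
  have "6 * (\<Sum>d<k. real d * (M - real d)) =
      3 * M * real k * (real k - 1) - (real k - 1) * real k * (2 * real k - 1)" for k M
    by (induction k) (simp_all add: algebra_simps)
  from this [where k = "2 * n" and M = "2 * real n"]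
  have closed: "(\<Sum>d<2 * n. real d * (2 * real n - real d)) = real n * (4 * real n ^ 2 - 1) / 3"
    by (simp add: algebra_simps power2_eq_square)
  have "(\<Sum>d<2 * n. cycle_green n d) =
      - (\<Sum>d<2 * n. real d * (2 * real n - real d)) / (4 * real n)"
    by (simp add: cycle_green_def sum_negf sum_divide_distrib)
  also have "\<dots> = - (4 * real n ^ 2 - 1) / 12"
    unfolding closed using n by (simp add: field_simps)
  finally show ?thesis .
qed

lemma alternating_sum_cycle_green:
  assumes n: "n > 0"
  shows "(\<Sum>d<2 * n. (-1) ^ d * cycle_green n d) = 1 / 4"
proof -
  have "(\<Sum>d<2 * k. (-1) ^ d * (real d * (M - real d))) = real k * (2 * real k - 1) - real k * M"
    for k M
    by (induction k) (simp_all add: algebra_simps)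
  from this [where k = n and M = "2 * real n"]
  have alt: "(\<Sum>d<2 * n. (-1) ^ d * (real d * (2 * real n - real d))) = - real n"
    by (simp add: algebra_simps)
  have "(\<Sum>d<2 * n. (-1) ^ d * cycle_green n d) =
      - (\<Sum>d<2 * n. (-1) ^ d * (real d * (2 * real n - real d))) / (4 * real n)"
    by (simp add: cycle_green_def sum_negf sum_divide_distrib)
  then show ?thesis
    using n by (simp add: alt)
qed

text \<open>Splitting \<open>load j = (5 + (-1)\<^sup>j) / 2\<close> into its mean and its alternating part turns the weighted
  sum of a function of the gap into the two sums above.  It counts the vertices of either graph over
  a position of the cycle when the vertex \<open>Tilde k\<close> is put at position \<open>2k\<close>: two over an odd
  position, three over an even one.\<close>

definition load :: "nat \<Rightarrow> real" where
  "load i = (5 + (-1) ^ i) / 2"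

lemma sum_load:
  fixes F :: "nat \<Rightarrow> real"
  shows "(\<Sum>i = 1..2 * n. load i * F i) = (\<Sum>k = 1..n. F (2 * k)) + 2 * (\<Sum>i = 1..2 * n. F i)"
  by (induction n) (simp_all add: load_def algebra_simps)

lemma sum_load_cycle_green:
  assumes n: "n > 0"
  shows "(\<Sum>i = 1..2 * n. \<Sum>j = 1..2 * n. load i * load j * cycle_green n (gap i j)) =
    real n * (7 - 25 * real n ^ 2) / 6"
proof -
  define A where "A = (\<Sum>d<2 * n. cycle_green n d)"
  define B where "B = (\<Sum>d<2 * n. (-1) ^ d * cycle_green n d)"
  have inner: "(\<Sum>j = 1..2 * n. load j * cycle_green n (gap i j)) = (5 * A + (-1) ^ i * B) / 2"
    if i: "i \<in> {1..2 * n}" for i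
  proof -
    have sign: "(-1 :: real) ^ j = (-1) ^ i * (-1) ^ gap i j" for j
      by (auto simp: gap_def minus_one_power_iff)
    have "(\<Sum>j = 1..2 * n. load j * cycle_green n (gap i j)) =
        (5 * (\<Sum>j = 1..2 * n. cycle_green n (gap i j)) +
         (-1) ^ i * (\<Sum>j = 1..2 * n. (-1) ^ gap i j * cycle_green n (gap i j))) / 2"
    proof -
      have "load j * cycle_green n (gap i j) = (5 * cycle_green n (gap i j) +
          (-1) ^ i * ((-1) ^ gap i j * cycle_green n (gap i j))) / 2" for j
        unfolding load_def sign [of j] by (simp add: algebra_simps)
      then show ?thesis
        by (simp only: sum_divide_distrib [symmetric] sum.distrib sum_distrib_left [symmetric])
    qed
    also have "(\<Sum>j = 1..2 * n. cycle_green n (gap i j)) = A"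
      unfolding A_def using i by (intro sum_gap_function cycle_green_reflect) auto
    also have "(\<Sum>j = 1..2 * n. (-1) ^ gap i j * cycle_green n (gap i j)) = B"
      unfolding B_def using i
      by (intro sum_gap_function [where h = "\<lambda>d. (-1) ^ d * cycle_green n d"])
         (auto simp: cycle_green_reflect minus_one_power_iff)
    finally show ?thesis .
  qed
  have alt: "(\<Sum>i = 1..2 * k. (-1 :: real) ^ i) = 0" for k
    by (induction k) simp_all
  have "(\<Sum>i = 1..2 * n. \<Sum>j = 1..2 * n. load i * load j * cycle_green n (gap i j)) =
      (\<Sum>i = 1..2 * n. load i * (\<Sum>j = 1..2 * n. load j * cycle_green n (gap i j)))"
    by (simp add: sum_distrib_left mult.assoc)
  also have "\<dots> = (\<Sum>i = 1..2 * n. (25 * A + B) / 4 + (-1) ^ i * ((5 * A + 5 * B) / 4))"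
  proof (intro sum.cong refl)
    fix i assume "i \<in> {1..2 * n}"
    then show "load i * (\<Sum>j = 1..2 * n. load j * cycle_green n (gap i j)) =
        (25 * A + B) / 4 + (-1) ^ i * ((5 * A + 5 * B) / 4)"
      by (simp only: inner, cases "even i") (simp_all add: load_def field_simps)
  qed
  also have "\<dots> = real (2 * n) * ((25 * A + B) / 4)"
    by (simp only: sum.distrib sum_distrib_right [symmetric] alt) simp
  also have "\<dots> = real n * (7 - 25 * real n ^ 2) / 6"
    unfolding A_def B_def sum_cycle_green [OF n] alternating_sum_cycle_green [OF n]
    by (simp add: field_simps power2_eq_square)
  finally show ?thesis .
qed

section \<open>The antisymmetric block\<close>

text \<open>The corner entries of a periodic matrix act on \<open>f\<close> as the ordinary off-diagonal entries
  would act on its continuation to the positions \<open>0\<close> and \<open>2n + 1\<close>.\<close>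

lemma periodic_mat_row:
  fixes f :: "nat \<Rightarrow> real"
  assumes n: "n \<ge> 2" and i: "1 \<le> i" "i \<le> 2 * n"
    and wrap: "f 0 = - c * f (2 * n)" "f (2 * n + 1) = - c * f 1"
  shows "(\<Sum>k<2 * n. periodic_mat a b c n $$ (i - 1, k) * f (k + 1)) =
    (if odd i then a else b) * f i - f (i - 1) - f (i + 1)"
proof -
  define d where "d = (if odd i then a else b)"
  have delta: "(\<Sum>k<m. if Suc k = j then x else 0) = (if 1 \<le> j \<and> j \<le> m then x else 0)"
    for m j and x :: real
    by (induction m) auto
  have entry: "periodic_mat a b c n $$ (i - 1, k) * f (k + 1) =
      (if Suc k = i then d * f i else 0) + (if Suc k = i + 1 then - f (i + 1) else 0)
      + (if Suc k = i - 1 then - f (i - 1) else 0)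
      + (if Suc k = 2 * n then (if i = 1 then c * f (2 * n) else 0) else 0)
      + (if Suc k = 1 then (if i = 2 * n then c * f 1 else 0) else 0)"
    if k: "k < 2 * n" for k
  proof -
    define j where "j = Suc k"
    have j: "1 \<le> j" "j \<le> 2 * n"
      using k by (auto simp: j_def)
    have "periodic_mat a b c n $$ (i - 1, k) =
      (if i = j then d
       else if j = i + 1 \<or> i = j + 1 then -1
       else if (i = 1 \<and> j = 2 * n) \<or> (i = 2 * n \<and> j = 1) then c else 0)"
      using k i by (cases i) (simp_all add: periodic_mat_def mat_from_1_def j_def d_def)
    moreover consider "j = i" | "j = i + 1" | "i = j + 1" | "j \<noteq> i" "j \<noteq> i + 1" "i \<noteq> j + 1"
      by blast
    then have "(if i = j then d
       else if j = i + 1 \<or> i = j + 1 then -1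
       else if (i = 1 \<and> j = 2 * n) \<or> (i = 2 * n \<and> j = 1) then c else 0) * f j =
      (if j = i then d * f i else 0) + (if j = i + 1 then - f (i + 1) else 0)
      + (if j = i - 1 then - f (i - 1) else 0)
      + (if j = 2 * n then (if i = 1 then c * f (2 * n) else 0) else 0)
      + (if j = 1 then (if i = 2 * n then c * f 1 else 0) else 0)"
      by cases (use n i j in auto)
    ultimately show ?thesis
      by (simp only: j_def Suc_eq_plus1)
  qed
  have "(\<Sum>k<2 * n. periodic_mat a b c n $$ (i - 1, k) * f (k + 1)) =
      d * f i + (if i + 1 \<le> 2 * n then - f (i + 1) else 0)
      + (if 1 \<le> i - 1 then - f (i - 1) else 0)
      + (if i = 1 then c * f (2 * n) else 0) + (if i = 2 * n then c * f 1 else 0)"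
  proof -
    have "(\<Sum>k<2 * n. periodic_mat a b c n $$ (i - 1, k) * f (k + 1)) =
      (\<Sum>k<2 * n. (if Suc k = i then d * f i else 0) + (if Suc k = i + 1 then - f (i + 1) else 0)
      + (if Suc k = i - 1 then - f (i - 1) else 0)
      + (if Suc k = 2 * n then (if i = 1 then c * f (2 * n) else 0) else 0)
      + (if Suc k = 1 then (if i = 2 * n then c * f 1 else 0) else 0))"
      by (intro sum.cong refl entry) simp
    moreover have "1 \<le> i + 1" "i - 1 \<le> 2 * n" "1 \<le> 2 * n" "1 \<le> (1::nat)" "2 * n \<le> 2 * n"
      using i n by auto
    ultimately show ?thesis
      using i by (simp only: sum.distrib delta simp_thms if_True)
  qed
  also have "\<dots> = d * f i - f (i - 1) - f (i + 1)"
    using wrap n i by (cases "i = 1"; cases "i = 2 * n") simp_all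
  finally show ?thesis
    unfolding d_def .
qed

definition antisym_green_mat :: "nat \<Rightarrow> real \<Rightarrow> real mat" where
  "antisym_green_mat n s = mat (2 * n) (2 * n) (\<lambda>(i, j). antisym_green n s (i + 1) (j + 1))"

lemma antisym_block_inverse:
  assumes n: "n \<ge> 2" and s: "s = 1 \<or> s = -1"
  shows "periodic_mat 4 3 (- s) n * antisym_green_mat n s = 1\<^sub>m (2 * n)"
proof (rule eq_matI)
  fix i j assume "i < dim_row (1\<^sub>m (2 * n) :: real mat)" "j < dim_col (1\<^sub>m (2 * n) :: real mat)"
  then have i: "i < 2 * n" and j: "j < 2 * n"
    by auto
  have ss: "s * s = 1" "s \<le> 1"
    using s by auto
  have dims: "dim_row (periodic_mat 4 3 (- s) n) = 2 * n" "dim_col (periodic_mat 4 3 (- s) n) = 2 * n"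
    by (simp_all add: periodic_mat_def mat_from_1_def)
  have "(periodic_mat 4 3 (- s) n * antisym_green_mat n s) $$ (i, j) =
      (\<Sum>k<2 * n. periodic_mat 4 3 (- s) n $$ (i + 1 - 1, k) * antisym_green n s (k + 1) (j + 1))"
    using i j by (simp add: antisym_green_mat_def scalar_prod_def dims lessThan_atLeast0)
  also have "\<dots> = (if odd (i + 1) then 4 else 3) * antisym_green n s (i + 1) (j + 1)
      - antisym_green n s (i + 1 - 1) (j + 1) - antisym_green n s (i + 1 + 1) (j + 1)"
    using i j antisym_green_wrap [OF _ _ ss(1), of "j + 1" n]
    by (intro periodic_mat_row [OF n]) auto
  also have "\<dots> = (if i + 1 = j + 1 then 1 else 0)"
    using i j ss by (intro antisym_green_equation) auto
  finally show "(periodic_mat 4 3 (- s) n * antisym_green_mat n s) $$ (i, j) = 1\<^sub>m (2 * n) $$ (i, j)"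
    using i j by simp
qed (simp_all add: antisym_green_mat_def periodic_mat_def mat_from_1_def)

lemma antisym_block_minor_quotient:
  assumes n: "n \<ge> 2" and s: "s = 1 \<or> s = -1"
  shows "principal_minor_sum (2 * n - 1) (periodic_mat 4 3 (- s) n) / det (periodic_mat 4 3 (- s) n)
    = (\<Sum>i = 1..2 * n. antisym_green n s i i)"
proof -
  have "principal_minor_sum (2 * n - 1) (periodic_mat 4 3 (- s) n) / det (periodic_mat 4 3 (- s) n)
      = (\<Sum>i<2 * n. antisym_green_mat n s $$ (i, i))"
    by (rule principal_minor_sum_quotient [OF _ _ antisym_block_inverse [OF n s]])
       (use n in \<open>auto simp: antisym_green_mat_def periodic_mat_def mat_from_1_def\<close>)
  also have "\<dots> = (\<Sum>i<2 * n. antisym_green n s (i + 1) (i + 1))"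
    by (simp add: antisym_green_mat_def)
  also have "\<dots> = (\<Sum>i = 1..2 * n. antisym_green n s i i)"
    by (rule sum.reindex_bij_witness [of _ "\<lambda>i. i - 1" "\<lambda>i. i + 1"]) auto
  finally show ?thesis .
qed

lemma sum_antisym_green_diag:
  "(\<Sum>i = 1..2 * n. antisym_green n s i i) = 7 * real n * screened_green n s 0 / (2 * sqrt 3)"
proof -
  have "(\<Sum>i = 1..2 * n. kappa i * kappa i) = 7 * real n"
    by (induction n) (simp_all add: kappa_def)
  then show ?thesis
    by (simp add: antisym_green_def sum_divide_distrib [symmetric] sum_distrib_right [symmetric])
qed

text \<open>With \<open>q = (5 + 2\<surd>6)\<^sup>n\<^sup>-\<^sup>1 = \<theta>\<^sup>2\<^sup>n\<^sup>-\<^sup>2\<close> both brackets of \<open>B\<^sub>n\<close> are combinations of \<open>q\<close> and \<open>q\<^sup>-\<^sup>1\<close>; the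
  parts of the second bracket that are free of \<open>n\<close> cancel the first one.\<close>

lemma B_num_eq:
  assumes n: "n \<ge> 1"
  shows "B_num n = 7 * real n * (theta ^ (2 * n) - (sqrt 3 - sqrt 2) ^ (2 * n)) / (4 * sqrt 6)"
proof -
  define q where "q = theta ^ (2 * (n - 1))"
  define p where "p = (sqrt 3 - sqrt 2) ^ (2 * (n - 1))"
  have s6: "sqrt 6 = sqrt 2 * sqrt 3"
    by (simp flip: real_sqrt_mult)
  have squares: "(sqrt 3 + sqrt 2)\<^sup>2 = 5 + 2 * sqrt 6" "(sqrt 3 - sqrt 2)\<^sup>2 = 5 - 2 * sqrt 6"
    by (simp_all add: power2_sum power2_diff s6)
  have e: "2 * n - 1 = 2 * (n - 1) + 1" "2 * n = 2 * (n - 1) + 2"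
    using n by auto
  have q': "(5 + 2 * sqrt 6) ^ (n - 1) = q" and p': "(5 - 2 * sqrt 6) ^ (n - 1) = p"
    by (simp_all add: q_def p_def power_mult theta_def squares)
  have powers: "(sqrt 3 + sqrt 2) ^ (2 * n - 1) = q * (sqrt 3 + sqrt 2)"
    "(sqrt 3 - sqrt 2) ^ (2 * n - 1) = p * (sqrt 3 - sqrt 2)"
    by (simp_all only: e(1) power_add q_def p_def theta_def power_one_right)
  have powers2: "theta ^ (2 * n) = q * (5 + 2 * sqrt 6)"
    "(sqrt 3 - sqrt 2) ^ (2 * n) = p * (5 - 2 * sqrt 6)"
    by (subst e(2), simp only: power_add q_def p_def theta_def squares)+
  have sq: "sqrt 2 * sqrt 2 = 2" "sqrt 3 * sqrt 3 = 3" "sqrt 2 * (sqrt 2 * x) = 2 * x"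
    "sqrt 3 * (sqrt 3 * x) = 3 * x" for x
    by (simp_all flip: mult.assoc)
  have "B_num n * (4 * sqrt 6) = 7 * real n * (theta ^ (2 * n) - (sqrt 3 - sqrt 2) ^ (2 * n))"
    unfolding B_num_def powers powers2 q' p'
    unfolding s6
    by (simp add: algebra_simps sq)
  then show ?thesis
    by (simp add: field_simps)
qed

lemma antisym_trace_closed_form:
  assumes n: "n \<ge> 1" and s: "s = 1 \<or> s = -1"
  shows "(\<Sum>i = 1..2 * n. antisym_green n s i i) =
    B_num n / ((sqrt 2 + sqrt 3) ^ (2 * n) + (sqrt 2 - sqrt 3) ^ (2 * n) - 2 * s)"
proof -
  define t where "t = theta ^ (2 * n)"
  define u where "u = (sqrt 3 - sqrt 2) ^ (2 * n)"
  have tu: "t * u = 1"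
    by (simp add: t_def u_def power_mult_distrib [symmetric] theta_inverse)
  have t: "t > 1"
    unfolding t_def using n by (intro one_less_power theta_gt_1) auto
  have ss: "s * s = 1"
    using s by auto
  have s6: "2 * sqrt 3 * (2 * sqrt 2) = 4 * sqrt 6"
    by (simp flip: real_sqrt_mult)
  have "(sqrt 2 - sqrt 3) ^ (2 * n) = u"
    unfolding u_def by (simp add: power_mult power2_commute)
  moreover have "(sqrt 2 + sqrt 3) ^ (2 * n) = t"
    by (simp add: t_def theta_def add.commute)
  ultimately have denom: "(sqrt 2 + sqrt 3) ^ (2 * n) + (sqrt 2 - sqrt 3) ^ (2 * n) - 2 * s = t + u - 2 * s"
    by simp
  have ts: "t - s \<noteq> 0"
    using t s by auto
  have square: "t * (t + u - 2 * s) = (t - s) * (t - s)"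
    using tu ss by (simp add: algebra_simps)
  then have pos: "t + u - 2 * s \<noteq> 0"
    using ts by auto
  have "(t + s) * (t + u - 2 * s) = (t - u) * (t - s)"
  proof -
    have "t * ((t + s) * (t + u - 2 * s)) = t * ((t - u) * (t - s))"
      using square tu ss by (simp add: algebra_simps) algebra
    then show ?thesis
      using t by simp
  qed
  then have ratio: "(t + s) / (t - s) = (t - u) / (t + u - 2 * s)"
    using ts pos by (simp add: frac_eq_eq)
  have "(\<Sum>i = 1..2 * n. antisym_green n s i i) =
      7 * real n * ((t + s) / (2 * sqrt 2 * (t - s))) / (2 * sqrt 3)"
    unfolding sum_antisym_green_diag screened_green_def t_def by simp
  also have "\<dots> = 7 * real n * ((t + s) / (t - s)) / (2 * sqrt 3 * (2 * sqrt 2))"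
    by simp
  also have "\<dots> = 7 * real n * (t - u) / (4 * sqrt 6) / (t + u - 2 * s)"
    unfolding s6 ratio by simp
  also have "7 * real n * (t - u) / (4 * sqrt 6) = B_num n"
    by (simp add: B_num_eq [OF n] t_def u_def)
  finally show ?thesis
    unfolding denom .
qed

section \<open>The symmetric block\<close>

text \<open>The rows of \<open>L_A\<close> refer to the orthonormal basis of the functions with equal values at
  \<open>Unprimed i\<close> and \<open>Primed i\<close> that consists of the indicators of the vertices \<open>Tilde k\<close> and of
  \<open>1 / \<surd>2\<close> times the indicators of the pairs.  In this basis \<open>wt\<close> is the constant function \<open>1\<close>.\<close>

definition wt :: "nat \<Rightarrow> nat \<Rightarrow> real" where
  "wt n r = (if r < n then 1 else sqrt 2)"

definition row_pos :: "nat \<Rightarrow> nat \<Rightarrow> nat" where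
  "row_pos n r = (if r < n then 2 * (r + 1) else r - n + 1)"

text \<open>The potential of a symmetric source.  A current that enters at a vertex \<open>Tilde k\<close> first crosses
  the two parallel edges at that vertex, of joint resistance \<open>1/2\<close>; from there, or directly for the
  other rows, it spreads over two copies of the cycle, which halves the Green's function.\<close>

definition sym_green :: "nat \<Rightarrow> nat \<Rightarrow> nat \<Rightarrow> real" where
  "sym_green n r c = wt n r * wt n c * cycle_green n (gap (row_pos n r) (row_pos n c)) / 2
     + (if r = c \<and> r < n then 1 / 2 else 0)"

lemma sum_lessThan_add:
  fixes f :: "nat \<Rightarrow> real"
  shows "(\<Sum>k<a + b. f k) = (\<Sum>k<a. f k) + (\<Sum>k<b. f (a + k))"
  by (induction b) simp_all

lemma sum_block_positions:
  fixes F :: "nat \<Rightarrow> real"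
  shows "(\<Sum>r<3 * n. wt n r * wt n r * F (row_pos n r)) = (\<Sum>i = 1..2 * n. load i * F i)"
proof -
  have "(\<Sum>r<3 * n. wt n r * wt n r * F (row_pos n r)) =
      (\<Sum>r<n + 2 * n. wt n r * wt n r * F (row_pos n r))"
    by simp
  also have "\<dots> = (\<Sum>k<n. F (2 * (k + 1))) + 2 * (\<Sum>k<2 * n. F (k + 1))"
    by (simp only: sum_lessThan_add) (simp add: wt_def row_pos_def sum_distrib_left)
  also have "(\<Sum>k<n. F (2 * (k + 1))) = (\<Sum>k = 1..n. F (2 * k))"
    by (rule sum.reindex_bij_witness [of _ "\<lambda>k. k - 1" "\<lambda>k. k + 1"]) auto
  also have "(\<Sum>k<2 * n. F (k + 1)) = (\<Sum>i = 1..2 * n. F i)"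
    by (rule sum.reindex_bij_witness [of _ "\<lambda>k. k - 1" "\<lambda>k. k + 1"]) auto
  finally show ?thesis
    by (simp only: sum_load)
qed

lemma L_A_carrier: "L_A n \<in> carrier_mat (3 * n) (3 * n)"
proof -
  have "L_A n \<in> carrier_mat (n + 2 * n) (n + 2 * n)"
    unfolding L_A_def by (rule four_block_carrier_mat)
      (simp_all add: C_mat_def periodic_mat_def mat_from_1_def)
  then show ?thesis
    by simp
qed

lemma L_A_index:
  assumes "r < 3 * n" "c < 3 * n"
  shows "L_A n $$ (r, c) =
    (if r < n then if c < n then (if r = c then 2 else 0)
                   else (if c = n + 2 * r + 1 then - sqrt 2 else 0)
     else if c < n then (if r = n + 2 * c + 1 then - sqrt 2 else 0)
     else C_mat n $$ (r - n, c - n))"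
  using assms unfolding L_A_def
  by (auto simp: C_mat_def N_mat_def periodic_mat_def mat_from_1_def)

lemma L_A_row_upper:
  fixes f :: "nat \<Rightarrow> real"
  assumes r: "r < n"
  shows "(\<Sum>c<3 * n. L_A n $$ (r, c) * f c) = 2 * f r - sqrt 2 * f (n + 2 * r + 1)"
proof -
  have "(\<Sum>c<3 * n. L_A n $$ (r, c) * f c) =
      (\<Sum>c<3 * n. (if c = r then 2 * f r else 0)
        + (if c = n + 2 * r + 1 then - sqrt 2 * f (n + 2 * r + 1) else 0))"
    by (intro sum.cong refl) (use r in \<open>auto simp: L_A_index\<close>)
  also have "\<dots> = 2 * f r - sqrt 2 * f (n + 2 * r + 1)"
    using r by (simp add: sum.distrib)
  finally show ?thesis .
qed

lemma L_A_row_lower: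
  fixes f g :: "nat \<Rightarrow> real"
  assumes n: "n \<ge> 2" and i: "1 \<le> i" "i \<le> 2 * n"
    and f: "\<And>k. k < 2 * n \<Longrightarrow> f (n + k) = g (k + 1)"
    and wrap: "g 0 = g (2 * n)" "g (2 * n + 1) = g 1"
  shows "(\<Sum>c<3 * n. L_A n $$ (n + i - 1, c) * f c) =
    (if odd i then 2 * g i else 3 * g i - sqrt 2 * f (i div 2 - 1)) - g (i - 1) - g (i + 1)"
proof -
  have "(\<Sum>c<3 * n. L_A n $$ (n + i - 1, c) * f c) =
      (\<Sum>c<n + 2 * n. L_A n $$ (n + i - 1, c) * f c)"
    by simp
  also have "\<dots> = (\<Sum>c<n. L_A n $$ (n + i - 1, c) * f c)
      + (\<Sum>k<2 * n. L_A n $$ (n + i - 1, n + k) * f (n + k))"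
    by (rule sum_lessThan_add)
  also have "(\<Sum>c<n. L_A n $$ (n + i - 1, c) * f c) =
      (\<Sum>c<n. if c = i div 2 - 1 then (if even i then - sqrt 2 * f (i div 2 - 1) else 0) else 0)"
  proof (intro sum.cong refl)
    fix c assume c: "c \<in> {..<n}"
    obtain p where p: "i = Suc p"
      using i by (cases i) auto
    have "L_A n $$ (n + i - 1, c) = (if p = 2 * c + 1 then - sqrt 2 else 0)"
      using c i by (subst L_A_index) (auto simp: p)
    moreover have "p = 2 * c + 1 \<longleftrightarrow> c = i div 2 - 1 \<and> even i"
      unfolding p by presburger
    ultimately show "L_A n $$ (n + i - 1, c) * f c =
        (if c = i div 2 - 1 then (if even i then - sqrt 2 * f (i div 2 - 1) else 0) else 0)"
      by simp
  qed
  also have "\<dots> = (if even i then - sqrt 2 * f (i div 2 - 1) else 0)"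
    using i by (auto simp: sum.delta)
  also have "(\<Sum>k<2 * n. L_A n $$ (n + i - 1, n + k) * f (n + k)) =
      (\<Sum>k<2 * n. periodic_mat 2 3 (-1) n $$ (i - 1, k) * g (k + 1))"
    by (intro sum.cong refl) (use i in \<open>auto simp: L_A_index f C_mat_def\<close>)
  also have "\<dots> = (if odd i then 2 else 3) * g i - g (i - 1) - g (i + 1)"
    by (rule periodic_mat_row [OF n i]) (use wrap in simp_all)
  finally show ?thesis
    by simp
qed

lemma cycle_green_wrap:
  assumes "1 \<le> j" "j \<le> 2 * n"
  shows "cycle_green n (gap 0 j) = cycle_green n (gap (2 * n) j)"
    and "cycle_green n (gap (2 * n + 1) j) = cycle_green n (gap 1 j)"
proof -
  have refl: "cycle_green n (2 * n - d) = 1 * cycle_green n d" if "d \<le> 2 * n" for d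
    using that by (simp add: cycle_green_reflect)
  have "cycle_green n (gap 0 j) = 1 * cycle_green n (gap (2 * n) j)"
    "cycle_green n (gap (2 * n + 1) j) = 1 * cycle_green n (gap 1 j)"
    by (rule gap_function_wrap [where h = "cycle_green n", OF refl assms], assumption)+
  then show "cycle_green n (gap 0 j) = cycle_green n (gap (2 * n) j)"
    "cycle_green n (gap (2 * n + 1) j) = cycle_green n (gap 1 j)"
    by simp_all
qed

lemma row_pos_bounds:
  assumes "r < 3 * n"
  shows "1 \<le> row_pos n r" "row_pos n r \<le> 2 * n"
  using assms by (auto simp: row_pos_def)

lemma L_A_null_vector:
  assumes n: "n \<ge> 2" and r: "r < 3 * n"
  shows "(\<Sum>c<3 * n. L_A n $$ (r, c) * wt n c) = 0"
proof (cases "r < n")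
  case True
  then show ?thesis
    by (simp add: L_A_row_upper wt_def)
next
  case False
  define i where "i = r - n + 1"
  have i: "1 \<le> i" "i \<le> 2 * n" and r': "r = n + i - 1"
    using False r by (auto simp: i_def)
  have "i div 2 - 1 < n"
    using i by auto
  then show ?thesis
    unfolding r' using i
    by (subst L_A_row_lower [OF n, where g = "\<lambda>_. sqrt 2"]) (auto simp: wt_def)
qed

text \<open>Column \<open>c\<close> of \<open>sym_green\<close> is the potential of a unit source at \<open>c\<close> against a load spread
  evenly over the cycle positions.\<close>

lemma sym_green_equation:
  assumes n: "n \<ge> 2" and r: "r < 3 * n" and c: "c < 3 * n"
  shows "(\<Sum>k<3 * n. L_A n $$ (r, k) * sym_green n k c) =
    (if r = c then 1 else 0) - (if r < n then 0 else 1 / (2 * sqrt 2 * real n)) * wt n c"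
proof -
  define j where "j = row_pos n c"
  have j: "1 \<le> j" "j \<le> 2 * n"
    using row_pos_bounds [OF c] by (simp_all add: j_def)
  show ?thesis
  proof (cases "r < n")
    case True
    have lower: "sym_green n (n + 2 * r + 1) c = sqrt 2 * (wt n c * cycle_green n (gap (2 * r + 2) j) / 2)"
      by (simp add: sym_green_def wt_def row_pos_def j_def)
    have upper: "sym_green n r c = wt n c * cycle_green n (gap (2 * r + 2) j) / 2
        + (if r = c then 1 / 2 else 0)"
      using True by (simp add: sym_green_def wt_def row_pos_def j_def)
    show ?thesis
      unfolding L_A_row_upper [OF True] lower upper using True by simp
  next
    case False
    define i where "i = r - n + 1"
    have i: "1 \<le> i" "i \<le> 2 * n" and r': "r = n + i - 1"
      using False r by (auto simp: i_def)
    define g where "g = (\<lambda>i. sqrt 2 * (wt n c * cycle_green n (gap i j) / 2))"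
    have lower: "sym_green n (n + k) c = g (k + 1)" for k
      by (simp add: sym_green_def g_def wt_def row_pos_def j_def)
    have upper: "sqrt 2 * sym_green n (i div 2 - 1) c =
        g i + (if c < n \<and> i = j then 1 / sqrt 2 else 0)" if "even i"
    proof -
      have "i div 2 - 1 < n" "row_pos n (i div 2 - 1) = i"
        using i that by (auto simp: row_pos_def)
      moreover have "i div 2 - 1 = c \<longleftrightarrow> c < n \<and> i = j"
        using i that by (auto simp: j_def row_pos_def split: if_splits)
      ultimately show ?thesis
        by (simp add: sym_green_def g_def wt_def j_def [symmetric] distrib_left real_div_sqrt)
    qed
    have "(\<Sum>k<3 * n. L_A n $$ (r, k) * sym_green n k c) =
        (if odd i then 2 * g i else 3 * g i - sqrt 2 * sym_green n (i div 2 - 1) c)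
        - g (i - 1) - g (i + 1)"
      unfolding r' using cycle_green_wrap [OF j]
      by (intro L_A_row_lower n i lower) (simp_all add: g_def)
    also have "\<dots> = 2 * g i - g (i - 1) - g (i + 1)
        - (if c < n \<and> i = j then 1 / sqrt 2 else 0)"
    proof -
      have "even i" if "c < n" "i = j"
        using that by (simp add: j_def row_pos_def)
      then show ?thesis
        using upper by auto
    qed
    also have "2 * g i - g (i - 1) - g (i + 1) = (2 * cycle_green n (gap i j)
        - cycle_green n (gap (i - 1) j) - cycle_green n (gap (i + 1) j)) * (wt n c * sqrt 2 / 2)"
      by (simp add: g_def field_simps)
    also have "\<dots> = ((if i = j then 1 else 0) - 1 / (2 * real n)) * (wt n c / sqrt 2)"
    proof -
      have "wt n c * sqrt 2 / 2 = wt n c / sqrt 2"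
        by (simp add: field_simps)
      then show ?thesis
        by (simp only: cycle_green_equation [OF i j])
    qed
    also have "\<dots> - (if c < n \<and> i = j then 1 / sqrt 2 else 0) =
        (if r = c then 1 else 0) - 1 / (2 * sqrt 2 * real n) * wt n c"
    proof (cases "c < n")
      case True
      then show ?thesis
        using False by (auto simp: wt_def algebra_simps)
    next
      case c: False
      then have "i = j \<longleftrightarrow> r = c"
        using False by (auto simp: i_def j_def row_pos_def)
      then show ?thesis
        using c by (auto simp: wt_def)
    qed
    finally show ?thesis
      using False by simp
  qed
qed

text \<open>The value of the quadratic form \<open>sym_green\<close> at the null vector \<open>wt\<close> of \<open>L_A\<close>, and at the same
  time the sum of all entries of the generalized inverse of the graph Laplacian; that both
  corrections are this one number links the matrix coefficients to the Kirchhoff index.\<close>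

definition sym_total :: "nat \<Rightarrow> real" where
  "sym_total n = (\<Sum>i = 1..2 * n. \<Sum>j = 1..2 * n. load i * load j * cycle_green n (gap i j)) / 2
     + real n / 2"

lemma alpha_quotient:
  assumes n: "n \<ge> 2"
  shows "- (alpha n (3 * n - 2) / alpha n (3 * n - 1)) =
    real n / 2 - sym_total n / (5 * real n)"
proof -
  have coeffs: "alpha n (3 * n - 2) = coeff (char_poly (L_A n)) 2"
    "alpha n (3 * n - 1) = coeff (char_poly (L_A n)) 1"
    using n by (simp_all add: alpha_def)
  have total_wt: "5 * real n = (\<Sum>r<3 * n. wt n r * wt n r)"
  proof -
    have "(\<Sum>i = 1..2 * m. load i) = 5 * real m" for m
      by (induction m) (simp_all add: load_def)
    then show ?thesis
      using sum_block_positions [of n "\<lambda>_. 1"] by simp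
  qed
  have delta: "(\<Sum>r<3 * n. if r < n then (1 :: real) / 2 else 0) = real n / 2"
  proof -
    have "(\<Sum>r<3 * n. if r < n then (1 :: real) / 2 else 0) = (\<Sum>r<n. 1 / 2)"
      by (rule sum.mono_neutral_cong_right) auto
    then show ?thesis
      by simp
  qed
  have trace: "(\<Sum>r<3 * n. sym_green n r r) = real n / 2"
    using delta by (simp add: sym_green_def)
  have "(\<Sum>r<3 * n. \<Sum>c<3 * n. wt n r * wt n c * sym_green n r c) =
      (\<Sum>r<3 * n. \<Sum>c<3 * n. wt n r * wt n r * (wt n c * wt n c *
         (cycle_green n (gap (row_pos n r) (row_pos n c)) / 2)))
      + (\<Sum>r<3 * n. \<Sum>c<3 * n. if r = c then (if r < n then 1 / 2 else 0) else 0)"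
    unfolding sum.distrib [symmetric]
    by (intro sum.cong refl) (auto simp: sym_green_def wt_def)
  also have "(\<Sum>r<3 * n. \<Sum>c<3 * n. if r = c then (if r < n then 1 / 2 else 0) else 0) = real n / 2"
    using delta by simp
  also have "(\<Sum>r<3 * n. \<Sum>c<3 * n. wt n r * wt n r * (wt n c * wt n c *
         (cycle_green n (gap (row_pos n r) (row_pos n c)) / 2))) =
      (\<Sum>i = 1..2 * n. load i * (\<Sum>j = 1..2 * n. load j * (cycle_green n (gap i j) / 2)))"
    by (simp only: sum_distrib_left [symmetric]
        sum_block_positions [where F = "\<lambda>j. cycle_green n (gap _ j) / 2"]
        sum_block_positions
          [where F = "\<lambda>i. \<Sum>j = 1..2 * n. load j * (cycle_green n (gap i j) / 2)"])
  also have "\<dots> + real n / 2 = sym_total n"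
    by (simp add: sym_total_def sum_distrib_left sum_divide_distrib mult.assoc)
  finally have total: "(\<Sum>r<3 * n. \<Sum>c<3 * n. wt n r * wt n c * sym_green n r c) = sym_total n" .
  have "- (coeff (char_poly (L_A n)) 2 / coeff (char_poly (L_A n)) 1) =
      (\<Sum>r<3 * n. sym_green n r r)
      - (\<Sum>r<3 * n. \<Sum>c<3 * n. wt n r * wt n c * sym_green n r c) / (5 * real n)"
    by (rule char_poly_coeff_quotient [OF L_A_carrier _ L_A_null_vector [OF n]
          sym_green_equation [OF n] total_wt]) (use n in auto)
  then show ?thesis
    by (simp only: coeffs trace total)
qed

lemma sym_trace_closed_form:
  assumes n: "n \<ge> 1"
  shows "real n / 2 - sym_total n / (5 * real n) = (25 * real n ^ 2 + 30 * real n - 13) / 60"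
proof -
  have pos: "n > 0"
    using n by simp
  show ?thesis
    unfolding sym_total_def sum_load_cycle_green [OF pos]
    using n by (simp add: field_simps power2_eq_square)
qed

section \<open>The generalized inverse of the graph Laplacians\<close>

definition side :: "bool \<Rightarrow> nat \<Rightarrow> vertex" where
  "side b i = (if b then Unprimed i else Primed i)"

definition pent_edges :: "bool \<Rightarrow> nat \<Rightarrow> vertex set set" where
  "pent_edges twisted n = (if twisted then moebius_edges n else cylinder_edges n)"

lemma pent_edges_alt:
  "pent_edges twisted n = pent_chain_edges n \<union>
     {{Unprimed (2 * n), side (\<not> twisted) 1}, {Primed (2 * n), side twisted 1}}"
  by (simp add: pent_edges_def cylinder_edges_def moebius_edges_def side_def)

definition rung :: "bool \<Rightarrow> nat \<Rightarrow> vertex" where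
  "rung b i = (if odd i then side (\<not> b) i else Tilde (i div 2))"

lemma chain_edges_cases:
  "{Unprimed i, Unprimed j} \<in> pent_chain_edges n \<longleftrightarrow>
     (j = i + 1 \<and> 1 \<le> i \<and> i + 1 \<le> 2 * n \<or> i = j + 1 \<and> 1 \<le> j \<and> j + 1 \<le> 2 * n)"
  "{Primed i, Primed j} \<in> pent_chain_edges n \<longleftrightarrow>
     (j = i + 1 \<and> 1 \<le> i \<and> i + 1 \<le> 2 * n \<or> i = j + 1 \<and> 1 \<le> j \<and> j + 1 \<le> 2 * n)"
  "{Unprimed i, Primed j} \<in> pent_chain_edges n \<longleftrightarrow> i = j \<and> odd i \<and> i \<le> 2 * n"
  "{Unprimed i, Tilde k} \<in> pent_chain_edges n \<longleftrightarrow> i = 2 * k \<and> 1 \<le> k \<and> k \<le> n"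
  "{Primed i, Tilde k} \<in> pent_chain_edges n \<longleftrightarrow> i = 2 * k \<and> 1 \<le> k \<and> k \<le> n"
  "{Tilde k, Tilde l} \<notin> pent_chain_edges n"
proof -
  show "{Unprimed i, Unprimed j} \<in> pent_chain_edges n \<longleftrightarrow>
     (j = i + 1 \<and> 1 \<le> i \<and> i + 1 \<le> 2 * n \<or> i = j + 1 \<and> 1 \<le> j \<and> j + 1 \<le> 2 * n)"
    unfolding pent_chain_edges_def by (simp add: doubleton_eq_iff) auto
  show "{Primed i, Primed j} \<in> pent_chain_edges n \<longleftrightarrow>
     (j = i + 1 \<and> 1 \<le> i \<and> i + 1 \<le> 2 * n \<or> i = j + 1 \<and> 1 \<le> j \<and> j + 1 \<le> 2 * n)"
    unfolding pent_chain_edges_def by (simp add: doubleton_eq_iff) auto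
  have "(\<exists>k. i = 2 * k - 1 \<and> 1 \<le> k \<and> k \<le> n) \<longleftrightarrow> odd i \<and> i \<le> 2 * n"
    by presburger
  then show "{Unprimed i, Primed j} \<in> pent_chain_edges n \<longleftrightarrow> i = j \<and> odd i \<and> i \<le> 2 * n"
    unfolding pent_chain_edges_def by (simp add: doubleton_eq_iff) auto
  show "{Unprimed i, Tilde k} \<in> pent_chain_edges n \<longleftrightarrow> i = 2 * k \<and> 1 \<le> k \<and> k \<le> n"
    "{Primed i, Tilde k} \<in> pent_chain_edges n \<longleftrightarrow> i = 2 * k \<and> 1 \<le> k \<and> k \<le> n"
    "{Tilde k, Tilde l} \<notin> pent_chain_edges n"
    unfolding pent_chain_edges_def by (auto simp: doubleton_eq_iff)
qed

lemma pent_neighbours_side: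
  assumes n: "n \<ge> 2" and i: "1 \<le> i" "i \<le> 2 * n"
  shows "{z. z \<in> pent_vertices n \<and> {side b i, z} \<in> pent_edges twisted n} =
    {if i = 2 * n then side (b \<noteq> twisted) 1 else side b (i + 1),
     if i = 1 then side (b \<noteq> twisted) (2 * n) else side b (i - 1),
     rung b i}"
    (is "?N = {?next, ?prev, _}")
proof (rule Set.set_eqI)
  fix z
  show "z \<in> ?N \<longleftrightarrow> z \<in> {?next, ?prev, rung b i}"
  proof (cases z)
    case (Tilde k)
    show ?thesis
      unfolding Tilde
      by (cases b; cases twisted; simp add: pent_edges_alt pent_vertices_def side_def rung_def
          chain_edges_cases doubleton_eq_iff image_iff; use n i in auto)
  next
    case (Unprimed j)
    have swap: "{Primed i, Unprimed j} = {Unprimed j, Primed i}" for i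
      by (rule insert_commute)
    show ?thesis
      unfolding Unprimed
      by (cases b; cases twisted; cases "i = 1"; cases "i = 2 * n";
          simp add: pent_edges_alt pent_vertices_def side_def rung_def swap
            chain_edges_cases doubleton_eq_iff image_iff;
          use n i in presburger)
  next
    case (Primed j)
    show ?thesis
      unfolding Primed
      by (cases b; cases twisted; cases "i = 1"; cases "i = 2 * n";
          simp add: pent_edges_alt pent_vertices_def side_def rung_def
            chain_edges_cases doubleton_eq_iff image_iff;
          use n i in presburger)
  qed
qed

lemma pent_neighbours_Tilde:
  assumes k: "1 \<le> k" "k \<le> n"
  shows "{z. z \<in> pent_vertices n \<and> {Tilde k, z} \<in> pent_edges twisted n} =
    {Unprimed (2 * k), Primed (2 * k)}" (is "?N = _")
proof (rule Set.set_eqI)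
  fix z
  show "z \<in> ?N \<longleftrightarrow> z \<in> {Unprimed (2 * k), Primed (2 * k)}"
    using k
    by (cases z) (auto simp: pent_edges_alt pent_vertices_def side_def doubleton_eq_iff
        insert_commute [of "Tilde k"] chain_edges_cases)
qed

text \<open>The two graphs differ only in how the ends of the strip are glued.  If \<open>\<Phi>\<close> continues \<open>\<phi>\<close> beyond
  both ends in accordance with the gluing, the Laplacian is that of the unrolled strip.\<close>

lemma pent_laplacian_side:
  fixes \<phi> :: "vertex \<Rightarrow> real" and \<Phi> :: "bool \<Rightarrow> nat \<Rightarrow> real"
  assumes n: "n \<ge> 2" and i: "1 \<le> i" "i \<le> 2 * n"
    and \<phi>: "\<And>b i. 1 \<le> i \<Longrightarrow> i \<le> 2 * n \<Longrightarrow> \<phi> (side b i) = \<Phi> b i"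
    and wrap: "\<And>b. \<Phi> b 0 = \<Phi> (b \<noteq> twisted) (2 * n)" "\<And>b. \<Phi> b (2 * n + 1) = \<Phi> (b \<noteq> twisted) 1"
  shows "(\<Sum>z | z \<in> pent_vertices n \<and> {side b i, z} \<in> pent_edges twisted n. \<phi> (side b i) - \<phi> z) =
    3 * \<Phi> b i - \<Phi> b (i - 1) - \<Phi> b (i + 1) - \<phi> (rung b i)"
proof -
  let ?next = "if i = 2 * n then side (b \<noteq> twisted) 1 else side b (i + 1)"
  let ?prev = "if i = 1 then side (b \<noteq> twisted) (2 * n) else side b (i - 1)"
  have dist: "?next \<noteq> ?prev" "?next \<noteq> rung b i" "?prev \<noteq> rung b i"
    using n i by (auto simp: side_def rung_def)
  have "\<phi> ?next = \<Phi> b (i + 1)"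
    using n i wrap(2) by (simp add: \<phi>)
  moreover have "\<phi> ?prev = \<Phi> b (i - 1)"
    using n i wrap(1) by (simp add: \<phi>)
  moreover have "(\<Sum>z | z \<in> pent_vertices n \<and> {side b i, z} \<in> pent_edges twisted n. \<phi> (side b i) - \<phi> z)
      = (\<phi> (side b i) - \<phi> ?next) + (\<phi> (side b i) - \<phi> ?prev) + (\<phi> (side b i) - \<phi> (rung b i))"
    unfolding pent_neighbours_side [OF n i] using dist by (simp only: sum.insert finite.intros
        sum.empty insert_iff empty_iff simp_thms add_0_right add.assoc)
  ultimately show ?thesis
    using i by (simp only: \<phi>)
qed

primrec pos :: "vertex \<Rightarrow> nat" where
  "pos (Tilde k) = 2 * k"
| "pos (Unprimed i) = i"
| "pos (Primed i) = i"

text \<open>The reflection that exchanges \<open>Unprimed i\<close> with \<open>Primed i\<close> fixes the vertices \<open>Tilde k\<close>, so an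
  antisymmetric function vanishes there.\<close>

primrec sgn_vertex :: "vertex \<Rightarrow> real" where
  "sgn_vertex (Tilde k) = 0"
| "sgn_vertex (Unprimed i) = 1"
| "sgn_vertex (Primed i) = -1"

definition is_tilde :: "vertex \<Rightarrow> bool" where
  "is_tilde v \<longleftrightarrow> v \<in> range Tilde"

lemma is_tilde_simps [simp]: "is_tilde (Tilde k)" "\<not> is_tilde (Unprimed i)" "\<not> is_tilde (Primed i)"
  by (auto simp: is_tilde_def)

text \<open>A unit source at \<open>u\<close> is the sum of its symmetric and its antisymmetric half; the three
  summands below are the potential of the symmetric half on the cycle, that of the antisymmetric
  half, and the voltage across the two edges at the source if that is a vertex \<open>Tilde k\<close>.\<close>

definition pent_green :: "nat \<Rightarrow> real \<Rightarrow> vertex \<Rightarrow> vertex \<Rightarrow> real" where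
  "pent_green n s w u = cycle_green n (gap (pos w) (pos u)) / 2
     + sgn_vertex w * sgn_vertex u * antisym_green n s (pos w) (pos u) / 2
     + (if w = u \<and> is_tilde w then 1 / 2 else 0)"

lemma pos_bounds:
  assumes "v \<in> pent_vertices n"
  shows "1 \<le> pos v" "pos v \<le> 2 * n"
  using assms by (auto simp: pent_vertices_def)

text \<open>The symmetric part of a column satisfies the equation of the cycle, the antisymmetric part
  that of \<open>L\<^sub>S\<close>: on a rung between the two strands the difference of the potentials is twice
  the antisymmetric part, which raises the diagonal entry at odd positions from \<open>2\<close> to \<open>4\<close>.\<close>

lemma pent_green_equation:
  assumes n: "n \<ge> 2" and s: "s = (if twisted then -1 else 1)"
    and w: "w \<in> pent_vertices n" and u: "u \<in> pent_vertices n"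
  shows "(\<Sum>z | z \<in> pent_vertices n \<and> {w, z} \<in> pent_edges twisted n.
      pent_green n s w u - pent_green n s z u) =
    (if w = u then 1 else 0) - (if is_tilde w then 0 else 1 / (4 * real n))"
proof -
  define j where "j = pos u"
  define c where "c = sgn_vertex u"
  have j: "1 \<le> j" "j \<le> 2 * n"
    using pos_bounds [OF u] by (simp_all add: j_def)
  have ss: "s * s = 1" "s \<le> 1"
    using s by auto
  define S where "S = (\<lambda>i. cycle_green n (gap i j) / 2)"
  define A where "A = (\<lambda>i. antisym_green n s i j / 2)"
  show ?thesis
  proof (cases "is_tilde w")
    case True
    then obtain k where w_eq: "w = Tilde k"
      by (auto simp: is_tilde_def)
    have k: "1 \<le> k" "k \<le> n"
      using w by (auto simp: w_eq pent_vertices_def)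
    have "(\<Sum>z | z \<in> pent_vertices n \<and> {w, z} \<in> pent_edges twisted n.
        pent_green n s w u - pent_green n s z u) =
      2 * pent_green n s (Tilde k) u - pent_green n s (Unprimed (2 * k)) u
      - pent_green n s (Primed (2 * k)) u"
      unfolding w_eq pent_neighbours_Tilde [OF k] by simp
    also have "\<dots> = (if w = u then 1 else 0)"
      by (simp add: pent_green_def w_eq)
    finally show ?thesis
      using True by simp
  next
    case False
    then obtain b i where w_eq: "w = side b i"
    proof (cases w)
      case (Unprimed i)
      then show ?thesis
        using that [of True i] by (simp add: side_def)
    next
      case (Primed i)
      then show ?thesis
        using that [of False i] by (simp add: side_def)
    qed simp
    define t where "t = (\<lambda>b. if b then 1 else - 1 :: real)"
    have i: "1 \<le> i" "i \<le> 2 * n"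
      using pos_bounds [OF w] by (auto simp: w_eq side_def split: if_splits)
    define \<Phi> where "\<Phi> = (\<lambda>b i. S i + t b * c * A i)"
    have on_side: "pent_green n s (side b i) u = \<Phi> b i" for b i
      by (simp add: pent_green_def \<Phi>_def S_def A_def side_def t_def j_def c_def)
    have t_flip: "t (b \<noteq> twisted) = t b * s" for b
      by (simp add: t_def s)
    have wrap: "\<Phi> b 0 = \<Phi> (b \<noteq> twisted) (2 * n)" "\<Phi> b (2 * n + 1) = \<Phi> (b \<noteq> twisted) 1" for b
      unfolding \<Phi>_def S_def A_def t_flip cycle_green_wrap [OF j] antisym_green_wrap [OF j ss(1)]
      by simp_all
    have "(\<Sum>z | z \<in> pent_vertices n \<and> {w, z} \<in> pent_edges twisted n.
        pent_green n s w u - pent_green n s z u) =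
      3 * \<Phi> b i - \<Phi> b (i - 1) - \<Phi> b (i + 1) - pent_green n s (rung b i) u"
      unfolding w_eq
      by (rule pent_laplacian_side [where \<phi> = "\<lambda>z. pent_green n s z u", OF n i on_side wrap])
    also have "pent_green n s (rung b i) u =
        (if odd i then S i - t b * c * A i else S i + (if rung b i = u then 1 / 2 else 0))"
    proof (cases "odd i")
      case True
      have "t (\<not> b) = - t b"
        by (simp add: t_def)
      then show ?thesis
        using True by (simp add: rung_def on_side \<Phi>_def)
    next
      case even: False
      then have "pos (rung b i) = i" "sgn_vertex (rung b i) = 0" "is_tilde (rung b i)"
        by (auto simp: rung_def)
      then show ?thesis
        using even by (simp add: pent_green_def S_def j_def)
    qed
    also have "3 * \<Phi> b i - \<Phi> b (i - 1) - \<Phi> b (i + 1) - \<dots> =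
        (2 * S i - S (i - 1) - S (i + 1))
        + t b * c * ((if odd i then 4 else 3) * A i - A (i - 1) - A (i + 1))
        - (if even i \<and> rung b i = u then 1 / 2 else 0)"
      by (simp add: \<Phi>_def algebra_simps)
    also have "2 * S i - S (i - 1) - S (i + 1) = ((if i = j then 1 else 0) - 1 / (2 * real n)) / 2"
    proof -
      have "2 * S i - S (i - 1) - S (i + 1) = (2 * cycle_green n (gap i j)
          - cycle_green n (gap (i - 1) j) - cycle_green n (gap (i + 1) j)) / 2"
        by (simp add: S_def diff_divide_distrib)
      then show ?thesis
        by (simp only: cycle_green_equation [OF i j])
    qed
    also have "(if odd i then 4 else 3) * A i - A (i - 1) - A (i + 1) = (if i = j then 1 / 2 else 0)"
    proof -
      have "(if odd i then 4 else 3) * A i - A (i - 1) - A (i + 1) =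
          ((if odd i then 4 else 3) * antisym_green n s i j
            - antisym_green n s (i - 1) j - antisym_green n s (i + 1) j) / 2"
        by (simp add: A_def diff_divide_distrib)
      then show ?thesis
        by (simp only: antisym_green_equation [OF i j ss(2)]) simp
    qed
    finally have sum_eq: "(\<Sum>z | z \<in> pent_vertices n \<and> {w, z} \<in> pent_edges twisted n.
        pent_green n s w u - pent_green n s z u) =
      ((if i = j then 1 else 0) - 1 / (2 * real n)) / 2 + t b * c * (if i = j then 1 / 2 else 0)
        - (if even i \<and> rung b i = u then 1 / 2 else 0)" .
    have "(if i = j then 1 else 0) / 2 + t b * c * (if i = j then 1 / 2 else 0)
        - (if even i \<and> rung b i = u then 1 / 2 else 0) = (if w = u then 1 else (0 :: real))"
    proof (cases u)
      case (Tilde k)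
      have "i = j \<longleftrightarrow> even i \<and> rung b i = u"
        by (auto simp: Tilde j_def rung_def side_def)
      then show ?thesis
        by (auto simp: c_def Tilde w_eq side_def)
    qed (auto simp: w_eq side_def rung_def t_def c_def j_def)
    then show ?thesis
      unfolding sum_eq using False by (simp add: diff_divide_distrib)
  qed
qed

section \<open>Summation over the vertices\<close>

lemma sum_pent_vertices:
  fixes F :: "vertex \<Rightarrow> real"
  shows "(\<Sum>v\<in>pent_vertices n. F v) = (\<Sum>k = 1..n. F (Tilde k))
    + (\<Sum>i = 1..2 * n. F (Unprimed i)) + (\<Sum>i = 1..2 * n. F (Primed i))"
proof -
  have inj: "inj_on Tilde X" "inj_on Unprimed X" "inj_on Primed X" for X
    by (auto simp: inj_on_def)
  have "(\<Sum>v\<in>pent_vertices n. F v) = (\<Sum>v\<in>Tilde ` {1..n} \<union> Unprimed ` {1..2 * n}. F v)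
      + (\<Sum>v\<in>Primed ` {1..2 * n}. F v)"
    unfolding pent_vertices_def by (rule sum.union_disjoint) auto
  also have "(\<Sum>v\<in>Tilde ` {1..n} \<union> Unprimed ` {1..2 * n}. F v) =
      (\<Sum>v\<in>Tilde ` {1..n}. F v) + (\<Sum>v\<in>Unprimed ` {1..2 * n}. F v)"
    by (rule sum.union_disjoint) auto
  finally show ?thesis
    by (simp add: sum.reindex inj)
qed

lemma finite_pent_vertices: "finite (pent_vertices n)"
  by (simp add: pent_vertices_def)

lemma card_pent_vertices: "real (card (pent_vertices n)) = 5 * real n"
  using sum_pent_vertices [of "\<lambda>_. 1" n] by simp

lemma sum_pent_positions:
  fixes F :: "nat \<Rightarrow> real"
  shows "(\<Sum>v\<in>pent_vertices n. F (pos v)) = (\<Sum>i = 1..2 * n. load i * F i)"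
  by (simp only: sum_load) (simp add: sum_pent_vertices)

lemma pent_green_trace:
  "(\<Sum>v\<in>pent_vertices n. pent_green n s v v) = real n / 2 + (\<Sum>i = 1..2 * n. antisym_green n s i i)"
  by (simp add: sum_pent_vertices pent_green_def sum_divide_distrib [symmetric])

lemma pent_green_total:
  "(\<Sum>w\<in>pent_vertices n. \<Sum>u\<in>pent_vertices n. pent_green n s w u) = sym_total n"
proof -
  have sym: "(\<Sum>w\<in>pent_vertices n. \<Sum>u\<in>pent_vertices n. cycle_green n (gap (pos w) (pos u)) / 2) =
      (\<Sum>i = 1..2 * n. load i * (\<Sum>j = 1..2 * n. load j * (cycle_green n (gap i j) / 2)))"
    by (simp only: sum_pent_positions [where F = "\<lambda>j. cycle_green n (gap _ j) / 2"]
        sum_pent_positions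
          [where F = "\<lambda>i. \<Sum>j = 1..2 * n. load j * (cycle_green n (gap i j) / 2)"])
  have antisym: "(\<Sum>u\<in>pent_vertices n.
      sgn_vertex w * sgn_vertex u * antisym_green n s (pos w) (pos u) / 2) = 0" for w
    by (simp add: sum_pent_vertices sum_negf)
  have tilde: "(\<Sum>w\<in>pent_vertices n. \<Sum>u\<in>pent_vertices n.
      if w = u \<and> is_tilde w then 1 / 2 else 0 :: real) = real n / 2"
  proof -
    have "(\<Sum>u\<in>pent_vertices n. if w = u \<and> is_tilde w then 1 / 2 else 0 :: real) =
        (if is_tilde w then 1 / 2 else 0)" if "w \<in> pent_vertices n" for w
      using that finite_pent_vertices by (cases "is_tilde w") auto
    then have "(\<Sum>w\<in>pent_vertices n. \<Sum>u\<in>pent_vertices n.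
        if w = u \<and> is_tilde w then 1 / 2 else 0 :: real) =
        (\<Sum>w\<in>pent_vertices n. if is_tilde w then 1 / 2 else 0)"
      by (rule sum.cong [OF refl])
    then show ?thesis
      by (simp add: sum_pent_vertices)
  qed
  have "(\<Sum>w\<in>pent_vertices n. \<Sum>u\<in>pent_vertices n. pent_green n s w u) =
      (\<Sum>i = 1..2 * n. load i * (\<Sum>j = 1..2 * n. load j * (cycle_green n (gap i j) / 2)))
      + real n / 2"
    by (simp only: pent_green_def sum.distrib sym antisym tilde) simp
  then show ?thesis
    by (simp add: sym_total_def sum_distrib_left sum_divide_distrib mult.assoc)
qed

lemma kirchhoff_index_pent:
  assumes n: "n \<ge> 2" and s: "s = (if twisted then -1 else 1)"
  shows "kirchhoff_index (pent_vertices n) (pent_edges twisted n) =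
    5 * real n * (real n / 2 - sym_total n / (5 * real n) + (\<Sum>i = 1..2 * n. antisym_green n s i i))"
proof -
  have "kirchhoff_index (pent_vertices n) (pent_edges twisted n) =
      real (card (pent_vertices n)) * (\<Sum>v\<in>pent_vertices n. pent_green n s v v)
      - (\<Sum>w\<in>pent_vertices n. \<Sum>u\<in>pent_vertices n. pent_green n s w u)"
    by (rule kirchhoff_index_generalized_inverse
        [OF finite_pent_vertices pent_green_equation [OF n s]])
  also have "\<dots> = 5 * real n * (real n / 2 + (\<Sum>i = 1..2 * n. antisym_green n s i i)) - sym_total n"
    by (simp only: card_pent_vertices pent_green_trace pent_green_total)
  also have "5 * real n * (real n / 2 + a) - t = 5 * real n * (real n / 2 - t / (5 * real n) + a)"
    for a t
    using n by (simp add: field_simps)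
  finally show ?thesis .
qed

theorem theorem1:
  fixes n :: nat
  assumes "n \<ge> 2"
  shows
    "kirchhoff_index (pent_vertices n) (cylinder_edges n) =
       5 * real n * (- (alpha n (3*n - 2) / alpha n (3*n - 1)) + beta n / det (L_S n)) \<and>
     5 * real n * (- (alpha n (3*n - 2) / alpha n (3*n - 1)) + beta n / det (L_S n)) =
       5 * real n * ((25 * real n ^ 2 + 30 * real n - 13) / 60
         + B_num n / ((sqrt 2 + sqrt 3) ^ (2*n) + (sqrt 2 - sqrt 3) ^ (2*n) - 2)) \<and>
     kirchhoff_index (pent_vertices n) (moebius_edges n) =
       5 * real n * (- (alpha n (3*n - 2) / alpha n (3*n - 1)) + beta' n / det (L_S' n)) \<and>
     5 * real n * (- (alpha n (3*n - 2) / alpha n (3*n - 1)) + beta' n / det (L_S' n)) =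
       5 * real n * ((25 * real n ^ 2 + 30 * real n - 13) / 60
         + B_num n / ((sqrt 2 + sqrt 3) ^ (2*n) + (sqrt 2 - sqrt 3) ^ (2*n) + 2))"
proof -
  have n1: "n \<ge> 1"
    using assms by simp
  have cyl: "beta n / det (L_S n) = (\<Sum>i = 1..2 * n. antisym_green n 1 i i)"
    using antisym_block_minor_quotient [OF assms, of 1] by (simp add: beta_def L_S_def)
  have moeb: "beta' n / det (L_S' n) = (\<Sum>i = 1..2 * n. antisym_green n (-1) i i)"
    using antisym_block_minor_quotient [OF assms, of "-1"] by (simp add: beta'_def L_S'_def)
  have edges: "cylinder_edges n = pent_edges False n" "moebius_edges n = pent_edges True n"
    by (simp_all add: pent_edges_def)
  have closed: "(\<Sum>i = 1..2 * n. antisym_green n 1 i i) =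
      B_num n / ((sqrt 2 + sqrt 3) ^ (2 * n) + (sqrt 2 - sqrt 3) ^ (2 * n) - 2)"
    "(\<Sum>i = 1..2 * n. antisym_green n (-1) i i) =
      B_num n / ((sqrt 2 + sqrt 3) ^ (2 * n) + (sqrt 2 - sqrt 3) ^ (2 * n) + 2)"
    using antisym_trace_closed_form [OF n1, of 1] antisym_trace_closed_form [OF n1, of "-1"]
    by simp_all
  have kf: "kirchhoff_index (pent_vertices n) (cylinder_edges n) =
      5 * real n * (- (alpha n (3*n - 2) / alpha n (3*n - 1)) + beta n / det (L_S n))"
    "kirchhoff_index (pent_vertices n) (moebius_edges n) =
      5 * real n * (- (alpha n (3*n - 2) / alpha n (3*n - 1)) + beta' n / det (L_S' n))"
    unfolding alpha_quotient [OF assms] cyl moeb edges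
    by (rule kirchhoff_index_pent [OF assms]; simp)+
  show ?thesis
    by (intro conjI kf)
       (simp_all only: alpha_quotient [OF assms] cyl moeb sym_trace_closed_form [OF n1] closed)
qed

end
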